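(* Let $t$ be an integer greater than $3$ and let \[ Q_t(a,b,c,d)=2ta^2+\frac{t}{2}b^2+tc^2+td^2+2tab+2tac+2tad+tbc+tbd+tcd. \] Then, as formal power series in $q$, \[ \prod_{\substack{n\ge 1\\ n\equiv 0,\,t-1,\,t,\,t+1 \ (\mathrm{mod}\ 2t)}}(1+q^n) \;=\; \sum_{a=0}^{\infty}\sum_{b=0}^{\infty}\sum_{c=0}^{\infty}\sum_{d=0}^{\infty} \frac{q^{Q_t(a,b,c,d)+\frac{t}{2}b-c+d}}{(q^{2t},q^{2t})_a\,(q^t,q^t)_b\,(q^t,q^t)_c\,(q^t,q^t)_d}. \] Moreover, the left-hand side is the generating function of the partitions into distinct parts each congruent to $0$, $t-1$, $t$ or $t+1$ modulo $2t$, and the right-hand side is the generating function of the partitions into distinct parts, each greater than $1$ and congruent to $0$, $1$ or $-1$ modulo $t$, such that the difference between any two consecutive parts is at least $t+1$ unless both of these parts are congruent to $0$ modulo $t$ or their sum is congruent to $0$ modulo $2t$.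
   Context: For a nonnegative integer $n$, $(x,q)_n=\prod_{i=0}^{n-1}(1-xq^i)$ denotes the $q$-Pochhammer symbol, with $(x,q)_0=1$; thus for example $(q^{t},q^{t})_b=\prod_{i=1}^{b}(1-q^{ti})$ and $(q^{2t},q^{2t})_a=\prod_{i=1}^{a}(1-q^{2ti})$. The generating function of a class of integer partitions is the formal power series $\sum_{n\ge 0}p(n)q^n$, where $p(n)$ is the number of partitions of $n$ in the class (the empty partition being the only partition of $0$). Two parts of a partition into distinct parts are consecutive if they are adjacent when the parts are listed in order of size. *)

theory Defs
  imports "HOL-Analysis.Analysis" "HOL-Number_Theory.Cong"
begin

definition qpochhammer :: "'a::comm_ring_1 \<Rightarrow> 'a \<Rightarrow> nat \<Rightarrow> 'a" where
  "qpochhammer x q n = (\<Prod>i<n. 1 - x * q ^ i)"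

text \<open>A partition is the weakly decreasing list of its parts.\<close>

definition is_partition :: "nat \<Rightarrow> nat list \<Rightarrow> bool" where
  "is_partition n p \<longleftrightarrow> sorted_wrt (\<ge>) p \<and> (\<forall>x\<in>set p. x > 0) \<and> sum_list p = n"

lemma finite_partitions: "finite {p. is_partition n p}"
proof (rule finite_subset)
  have "length p \<le> sum_list p" if "\<forall>x\<in>set p. x > 0" for p :: "nat list"
    using that by (induction p) auto
  then show "{p. is_partition n p} \<subseteq> {p. set p \<subseteq> {..n} \<and> length p \<le> n}"
    by (auto simp: is_partition_def member_le_sum_list)
  show "finite {p. set p \<subseteq> {..n} \<and> length p \<le> n}"
    by (rule finite_lists_length_le) simp
qed

definition partition_gf :: "(nat list \<Rightarrow> bool) \<Rightarrow> rat fps" where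
  "partition_gf C = Abs_fps (\<lambda>n. of_nat (card {p. is_partition n p \<and> C p}))"

definition product_class :: "nat \<Rightarrow> nat list \<Rightarrow> bool" where
  "product_class t p \<longleftrightarrow> distinct p \<and>
     (\<forall>x\<in>set p. [x = 0] (mod 2 * t) \<or> [x = t - 1] (mod 2 * t) \<or>
                [x = t] (mod 2 * t) \<or> [x = t + 1] (mod 2 * t))"

definition sum_class :: "nat \<Rightarrow> nat list \<Rightarrow> bool" where
  "sum_class t p \<longleftrightarrow> distinct p \<and>
     (\<forall>x\<in>set p. x > 1 \<and>
        ([int x = 0] (mod int t) \<or> [int x = 1] (mod int t) \<or> [int x = - 1] (mod int t))) \<and>
     (\<forall>i. Suc i < length p \<longrightarrow>
        int (p ! i) - int (p ! Suc i) \<ge> int t + 1 \<or>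
        ([p ! i = 0] (mod t) \<and> [p ! Suc i = 0] (mod t)) \<or>
        [p ! i + p ! Suc i = 0] (mod 2 * t))"

definition product_factor :: "nat \<Rightarrow> nat \<Rightarrow> rat fps" where
  "product_factor t n =
     (if n \<ge> 1 \<and> ([n = 0] (mod 2 * t) \<or> [n = t - 1] (mod 2 * t) \<or>
                   [n = t] (mod 2 * t) \<or> [n = t + 1] (mod 2 * t))
      then 1 + fps_X ^ n else 1)"

definition Q :: "real \<Rightarrow> real \<Rightarrow> real \<Rightarrow> real \<Rightarrow> real \<Rightarrow> real" where
  "Q t a b c d = 2*t*a^2 + t/2*b^2 + t*c^2 + t*d^2
     + 2*t*a*b + 2*t*a*c + 2*t*a*d + t*b*c + t*b*d + t*c*d"

definition sum_exponent :: "nat \<Rightarrow> nat \<Rightarrow> nat \<Rightarrow> nat \<Rightarrow> nat \<Rightarrow> nat" where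
  "sum_exponent t a b c d =
     nat \<lfloor>Q (real t) (real a) (real b) (real c) (real d) + real t / 2 * real b - real c + real d\<rfloor>"

text \<open>Neither the floor nor the truncation at zero changes the exponent.\<close>

lemma real_sum_exponent:
  assumes "t > 0"
  shows "real (sum_exponent t a b c d) =
     Q (real t) (real a) (real b) (real c) (real d) + real t / 2 * real b - real c + real d"
proof -
  define m where "m = b * (b + 1) div 2"
  have "2 * m = b * (b + 1)" unfolding m_def by simp
  then have m: "2 * real m = real b * (real b + 1)"
    by (metis of_nat_1 of_nat_add of_nat_mult of_nat_numeral)
  have "c * 1 \<le> c * (t * c)" using assms by (cases "c = 0") auto
  then have le: "c \<le> t * c^2" by (simp add: power2_eq_square algebra_simps)
  define e where "e = 2*t*a^2 + t*m + (t*c^2 - c) + t*d^2 + 2*t*a*b + 2*t*a*c + 2*t*a*d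
     + t*b*c + t*b*d + t*c*d + d"
  have "real t / 2 * (real b)^2 + real t / 2 * real b = real t / 2 * (real b * (real b + 1))"
    by (simp add: power2_eq_square algebra_simps)
  also have "\<dots> = real t * real m" unfolding m[symmetric] by simp
  finally have e: "Q (real t) (real a) (real b) (real c) (real d) + real t / 2 * real b
      - real c + real d = real e"
    unfolding Q_def e_def using le by (simp add: of_nat_diff algebra_simps)
  show ?thesis unfolding sum_exponent_def e by simp
qed

definition sum_term :: "nat \<Rightarrow> nat \<times> nat \<times> nat \<times> nat \<Rightarrow> rat fps" where
  "sum_term t = (\<lambda>(a, b, c, d).
     fps_X ^ sum_exponent t a b c d /
       (qpochhammer (fps_X ^ (2 * t)) (fps_X ^ (2 * t)) a * qpochhammer (fps_X ^ t) (fps_X ^ t) b *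
        qpochhammer (fps_X ^ t) (fps_X ^ t) c * qpochhammer (fps_X ^ t) (fps_X ^ t) d))"

end

theory Submission
  imports Defs
begin

text \<open>Put \<open>x = q ^ t\<close>. Euler's expansion sums the quadruple series over \<open>b\<close>, and the \<open>q\<close>-Chu--Vandermonde
  sum then sums it over \<open>a\<close> with \<open>i = a + d\<close> and \<open>j = a + c\<close> fixed. What remains is a double series in
  \<open>i, j\<close> which, by Euler's expansion again, factors into the product. Inserting \<open>x ^ (N * (i + j))\<close> and a
  shifted tail of \<open>(1 + x) (1 + x ^ 2) \<cdots>\<close> into the double series gives a family in \<open>N\<close>. It
  satisfies the recurrences that the partitions of the sum class with smallest part at least
  \<open>t * (N + 1) - 1\<close> obey when the smallest part is removed; the recurrences determine the family, since
  both sides tend to \<open>1\<close> as \<open>N\<close> grows.\<close>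

text \<open>The recurrences already hold for the single terms of the double series. In them,
  removing a part congruent to 1 modulo \<open>t\<close> lowers \<open>i\<close> by one, a part
  congruent to -1 lowers \<open>j\<close>, and a multiple of \<open>t\<close> changes neither. Two
  families in \<open>N\<close> are needed because of the gap condition. Once a smallest part
  \<open>t * k\<close> or \<open>t * k + 1\<close> is removed, the rest is restricted only by a
  lower bound; after \<open>t * k - 1\<close> the next part may also be \<open>t * k + 1\<close>,
  since the two add up to \<open>2 * t * k\<close>. Eliminating the bound \<open>t * k + 1\<close>
  leaves the bounds \<open>t * k - 1\<close> and \<open>t * k\<close>, and the exceptional pair
  produces the jump from \<open>N\<close> to \<open>N + 2\<close>. The parameter \<open>N\<close> is
  needed because removing parts raises the lower bound. The separation of \<open>i\<close> and
  \<open>j\<close> used for the product, however, relies on \<open>N = 0\<close>: for larger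
  \<open>N\<close> the factors \<open>1 + x ^ k\<close> with \<open>i + j < k <= N + i + j\<close>
  are missing, and the rest depends on \<open>i + j\<close>. So the two partition classes meet only
  at \<open>N = 0\<close>.\<close>

unbundle no vec_syntax
unbundle fps_syntax

subsection \<open>Sums and limits of formal power series\<close>

text \<open>Convergence of power series means that every coefficient eventually equals that of the
  limit. This instance and the next open the general rules for \<open>has_sum\<close> and
  \<open>tendsto\<close> to sums and products of power series.\<close>

instance fps :: (ab_group_add) topological_ab_group_add
proof
  show "LIM x nhds a \<times>\<^sub>F nhds b. fst x + snd x :> nhds (a + b)" for a b :: "'a fps"
  proof (rule tendsto_fpsI)
    fix n
    have "\<forall>\<^sub>F x in nhds a \<times>\<^sub>F nhds b. fst x $ n = a $ n"
      "\<forall>\<^sub>F x in nhds a \<times>\<^sub>F nhds b. snd x $ n = b $ n"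
      using filterlim_fst[of "nhds a" "nhds b"] filterlim_snd[of "nhds b" "nhds a"]
      by (simp_all add: tendsto_fps_iff)
    then show "\<forall>\<^sub>F x in nhds a \<times>\<^sub>F nhds b. (fst x + snd x) $ n = (a + b) $ n"
      by eventually_elim simp
  qed
  show "(uminus \<longlongrightarrow> - a) (nhds a)" for a :: "'a fps"
  proof (rule tendsto_fpsI)
    fix n
    have "\<forall>\<^sub>F x in nhds a. x $ n = a $ n"
      using filterlim_ident[of "nhds a"] by (simp add: tendsto_fps_iff)
    then show "\<forall>\<^sub>F x in nhds a. (- x) $ n = (- a) $ n"
      by eventually_elim simp
  qed
qed

instance fps :: (ring_1) topological_semigroup_mult
proof
  show "LIM x nhds a \<times>\<^sub>F nhds b. fst x * snd x :> nhds (a * b)" for a b :: "'a fps"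
  proof (rule tendsto_fpsI)
    fix n
    have "\<forall>\<^sub>F x in nhds a \<times>\<^sub>F nhds b. \<forall>m\<in>{..n}. fst x $ m = a $ m"
      "\<forall>\<^sub>F x in nhds a \<times>\<^sub>F nhds b. \<forall>m\<in>{..n}. snd x $ m = b $ m"
      using filterlim_fst[of "nhds a" "nhds b"] filterlim_snd[of "nhds b" "nhds a"]
      by (simp_all add: tendsto_fps_iff eventually_ball_finite_distrib)
    then show "\<forall>\<^sub>F x in nhds a \<times>\<^sub>F nhds b. (fst x * snd x) $ n = (a * b) $ n"
      by eventually_elim (simp add: fps_mult_nth)
  qed
qed

lemma summable_on_fpsI:
  fixes f :: "'b \<Rightarrow> 'a::ab_group_add fps"
  assumes "\<And>n. finite {k \<in> A. f k $ n \<noteq> 0}"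
  shows "f summable_on A"
proof -
  have "(f has_sum Abs_fps (\<lambda>n. \<Sum>k | k \<in> A \<and> f k $ n \<noteq> 0. f k $ n)) A"
    by (rule has_sum_fpsI) (use assms in auto)
  then show ?thesis
    by (rule has_sum_imp_summable)
qed

lemma has_sum_fps_nth_eq:
  fixes f :: "'b \<Rightarrow> 'a::ab_group_add fps"
  assumes "(f has_sum S) A" "k0 \<in> A" "\<And>k. k \<in> A \<Longrightarrow> k \<noteq> k0 \<Longrightarrow> f k $ n = 0"
  shows "S $ n = f k0 $ n"
proof -
  have "S $ n = (\<Sum>k | k \<in> A \<and> f k $ n \<noteq> 0. f k $ n)"
    by (rule has_sum_fpsD[OF assms(1)])
  also have "\<dots> = (\<Sum>k\<in>{k0}. f k $ n)"
    by (rule sum.mono_neutral_left) (use assms in auto)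
  finally show ?thesis by simp
qed

lemma fps_mult_nth_0_left:
  fixes f :: "'a::semiring_0 fps"
  assumes "\<And>m. m \<le> n \<Longrightarrow> f $ m = 0"
  shows "(f * g) $ n = 0"
  using assms by (simp add: fps_mult_nth)

lemma fps_power_nth_0:
  fixes y :: "'a::comm_ring_1 fps"
  assumes "y $ 0 = 0" "n < k"
  shows "(y ^ k) $ n = 0"
  using startsby_zero_power_prefix[OF assms(1)] assms(2) by blast

text \<open>Used for index shifts: terms whose index would become negative are set to 0, and then
  shifting along \<open>h\<close> keeps the sum. The recurrences of \<open>euler_sum\<close>,
  \<open>lower_sum\<close> and \<open>mid_sum\<close> are assembled in this way.\<close>

lemma has_sum_inj_extend:
  fixes f :: "'b \<Rightarrow> 'a::{comm_monoid_add, topological_space}"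
  assumes "(f has_sum S) UNIV" "inj h"
    and "\<And>k. g (h k) = f k" "\<And>k. k \<notin> range h \<Longrightarrow> g k = 0"
  shows "(g has_sum S) UNIV"
proof -
  have "((g \<circ> h) has_sum S) UNIV"
    using assms(1,3) by (simp add: o_def)
  then have "(g has_sum S) (range h)"
    using assms(2) by (subst has_sum_reindex)
  then show ?thesis
    by (rule has_sum_cong_neutral[THEN iffD1, rotated -1]) (use assms(4) in auto)
qed

subsection \<open>Euler's expansion\<close>

lemma qpochhammer_0 [simp]: "qpochhammer x q 0 = 1"
  by (simp add: qpochhammer_def)

lemma qpochhammer_Suc: "qpochhammer x q (Suc n) = qpochhammer x q n * (1 - x * q ^ n)"
  by (simp add: qpochhammer_def)

lemma qpochhammer_Suc_left: "qpochhammer x q (Suc n) = (1 - x) * qpochhammer (x * q) q n"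
  unfolding qpochhammer_def by (subst prod.lessThan_Suc_shift) (simp add: mult.assoc)

lemma qpochhammer_nth_0:
  fixes x :: "'a::comm_ring_1 fps"
  assumes "x $ 0 = 0"
  shows "qpochhammer x q n $ 0 = 1"
  using assms by (induction n) (auto simp: qpochhammer_Suc)

lemma fps_inverse_mult_cancel:
  fixes f g :: "'a::field fps"
  assumes "g $ 0 \<noteq> 0"
  shows "inverse (f * g) * g = inverse f"
  using assms by (simp add: fps_inverse_mult mult.assoc inverse_mult_eq_1)

lemma inverse_qpochhammer_Suc:
  fixes x :: "'a::field fps"
  assumes "x $ 0 = 0"
  shows "inverse (qpochhammer x q n) = inverse (qpochhammer x q (Suc n)) * (1 - x * q ^ n)"
  unfolding qpochhammer_Suc using assms by (subst fps_inverse_mult_cancel) auto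

text \<open>Terms of Euler's series for the product of \<open>1 + y * q ^ k\<close> over all
  \<open>k >= 0\<close>; \<open>tendsto_qpochhammer\<close> identifies the two.\<close>

definition euler_term :: "'a::field fps \<Rightarrow> 'a fps \<Rightarrow> nat \<Rightarrow> 'a fps" where
  "euler_term y q k = y ^ k * q ^ (k choose 2) * inverse (qpochhammer q q k)"

definition euler_sum :: "'a::field fps \<Rightarrow> 'a fps \<Rightarrow> 'a fps" where
  "euler_sum y q = (\<Sum>\<^sub>\<infinity>k. euler_term y q k)"

context
  fixes y q :: "'a::field fps"
  assumes y0: "y $ 0 = 0"
begin

lemma euler_term_nth_0: "n < k \<Longrightarrow> euler_term y q k $ n = 0"
  unfolding euler_term_def mult.assoc
  by (rule fps_mult_nth_0_left) (simp add: fps_power_nth_0 y0)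

lemma has_sum_euler: "(euler_term y q has_sum euler_sum y q) UNIV"
  unfolding euler_sum_def
proof (intro has_sum_infsum summable_on_fpsI)
  fix n
  have "{k \<in> UNIV. euler_term y q k $ n \<noteq> 0} \<subseteq> {..n}"
    using euler_term_nth_0 by (auto simp: not_le[symmetric])
  then show "finite {k \<in> UNIV. euler_term y q k $ n \<noteq> 0}"
    by (rule finite_subset) simp
qed

end

text \<open>The \<open>k\<close>-th term at \<open>y * q\<close> is the \<open>k\<close>-th term at
  \<open>y\<close> times \<open>q ^ k\<close>. Shifted by one and multiplied by \<open>y\<close>,
  the series at \<open>y * q\<close> gives the \<open>k\<close>-th term at \<open>y\<close> times
  \<open>1 - q ^ k\<close>. The two multipliers add up to 1.\<close>

lemma euler_sum_rec:
  fixes y q :: "'a::field fps"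
  assumes y0: "y $ 0 = 0" and q0: "q $ 0 = 0"
  shows "euler_sum y q = (1 + y) * euler_sum (y * q) q"
proof -
  let ?f = "euler_term y q" and ?g = "euler_term (y * q) q"
  have g: "(?g has_sum euler_sum (y * q) q) UNIV"
    by (rule has_sum_euler) (use y0 in auto)
  have "((\<lambda>k. if k = 0 then 0 else ?g (k - 1)) has_sum euler_sum (y * q) q) UNIV"
    by (rule has_sum_inj_extend[OF g inj_Suc]) (auto simp: image_iff gr0_conv_Suc)
  then have "((\<lambda>k. ?g k + y * (if k = 0 then 0 else ?g (k - 1))) has_sum
      euler_sum (y * q) q + y * euler_sum (y * q) q) UNIV"
    by (intro has_sum_add has_sum_cmult_right g)
  moreover have "?g k + y * (if k = 0 then 0 else ?g (k - 1)) = ?f k" for k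
  proof (cases k)
    case (Suc m)
    have "Suc m choose 2 = m + (m choose 2)"
      by (simp add: numeral_2_eq_2)
    then show ?thesis
      unfolding Suc euler_term_def
      by (simp add: inverse_qpochhammer_Suc[OF q0, of q m] power_add power_mult_distrib algebra_simps)
  qed (simp add: euler_term_def)
  ultimately have "(?f has_sum euler_sum (y * q) q + y * euler_sum (y * q) q) UNIV"
    by simp
  with has_sum_euler[OF y0] have "euler_sum y q = euler_sum (y * q) q + y * euler_sum (y * q) q"
    by (rule has_sum_unique)
  then show ?thesis
    by (simp add: algebra_simps)
qed

lemma euler_sum_eq_prod:
  fixes y q :: "'a::field fps"
  assumes "y $ 0 = 0" "q $ 0 = 0"
  shows "euler_sum y q = qpochhammer (- y) q M * euler_sum (y * q ^ M) q"
proof (induction M)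
  case (Suc M)
  have "euler_sum (y * q ^ M) q = (1 + y * q ^ M) * euler_sum (y * q ^ M * q) q"
    by (rule euler_sum_rec) (use assms in auto)
  then show ?case
    using Suc by (simp add: qpochhammer_Suc mult_ac)
qed simp

lemma euler_sum_nth:
  fixes y q :: "'a::field fps"
  assumes "\<And>m. m \<le> n \<Longrightarrow> y $ m = 0"
  shows "euler_sum y q $ n = (if n = 0 then 1 else 0)"
proof -
  have "euler_sum y q $ n = euler_term y q 0 $ n"
  proof (rule has_sum_fps_nth_eq[OF has_sum_euler])
    fix k :: nat assume "k \<noteq> 0"
    then obtain m where "k = Suc m" by (auto simp: gr0_conv_Suc)
    show "euler_term y q k $ n = 0"
      unfolding \<open>k = Suc m\<close> euler_term_def power_Suc mult.assoc
      by (intro fps_mult_nth_0_left assms)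
  qed (use assms in auto)
  then show ?thesis
    by (simp add: euler_term_def numeral_2_eq_2)
qed

text \<open>After \<open>M\<close> steps of the functional equation the remaining factor
  \<open>euler_sum (y * q ^ M) q\<close> agrees with 1 up to degree \<open>M\<close>, since
  \<open>y * q ^ M\<close> has no coefficient below degree \<open>M + 1\<close>.\<close>

lemma tendsto_qpochhammer:
  fixes y q :: "'a::field fps"
  assumes "y $ 0 = 0" "q $ 0 = 0"
  shows "qpochhammer (- y) q \<longlonglongrightarrow> euler_sum y q"
proof (rule tendsto_fpsI)
  fix n
  have "qpochhammer (- y) q M $ n = euler_sum y q $ n" if "M \<ge> n" for M
  proof -
    have "euler_sum (y * q ^ M) q $ m = (if m = 0 then 1 else 0)" if "m \<le> n" for m
    proof (rule euler_sum_nth)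
      fix k assume "k \<le> m"
      with that \<open>M \<ge> n\<close> have *: "k < Suc M" by simp
      have "i + j < Suc M \<Longrightarrow> y $ i * (q ^ M) $ j = 0" for i j
        using assms fps_power_nth_0[of q j M] by (cases "i = 0") auto
      then show "(y * q ^ M) $ k = 0"
        unfolding fps_mult_nth using * by (intro sum.neutral) auto
    qed
    then have "(qpochhammer (- y) q M * euler_sum (y * q ^ M) q) $ n
        = (\<Sum>i=0..n. qpochhammer (- y) q M $ i * (if n - i = 0 then 1 else 0))"
      unfolding fps_mult_nth by (intro sum.cong) auto
    also have "\<dots> = (\<Sum>i\<in>{n}. qpochhammer (- y) q M $ i)"
      by (rule sum.mono_neutral_cong_right) auto
    finally show ?thesis
      using euler_sum_eq_prod[OF assms, of M] by simp
  qed
  then show "\<forall>\<^sub>F M in sequentially. qpochhammer (- y) q M $ n = euler_sum y q $ n"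
    by (auto simp: eventually_sequentially)
qed

subsection \<open>The \<open>q\<close>-Chu--Vandermonde sum\<close>

context
  fixes x :: "'a::field fps"
  assumes x0: "x $ 0 = 0"
begin

private abbreviation (input) I :: "nat \<Rightarrow> 'a fps" where
  "I n \<equiv> inverse (qpochhammer x x n)"

private abbreviation (input) A :: "'a fps \<Rightarrow> nat \<Rightarrow> 'a fps" where
  "A y n \<equiv> qpochhammer (y * x) x n"

private abbreviation (input) W :: "'a fps \<Rightarrow> nat \<Rightarrow> 'a fps" where
  "W y n \<equiv> inverse (A y n)"

text \<open>The usual convention that \<open>1 / (x; x)_m\<close> vanishes for negative
  \<open>m\<close>; truncated subtraction would give 1.\<close>

private definition J :: "nat \<Rightarrow> nat \<Rightarrow> 'a fps" where
  "J n a = (if a \<le> n then I (n - a) else 0)"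

text \<open>Split \<open>1 - x ^ Suc n\<close> as
  \<open>x ^ a * (1 - x ^ (Suc n - a)) + (1 - x ^ a)\<close>. The first bracket cancels the last
  factor of \<open>(x; x)_(Suc n - a)\<close>, the second that of \<open>(x; x)_a\<close>.\<close>

private lemma J_rec:
  "(1 - x ^ Suc n) * I a * J (Suc n) a =
     x ^ a * I a * J n a + (if a = 0 then 0 else I (a - 1) * J (Suc n) a)"
proof -
  have I_Suc: "I m = I (Suc m) * (1 - x ^ Suc m)" for m
    using inverse_qpochhammer_Suc[OF x0, of x m] by simp
  consider "a \<le> n" | "a = Suc n" | "a > Suc n" by linarith
  then show ?thesis
  proof cases
    case 1
    then obtain m where n: "n = a + m" by (auto simp: le_iff_add)
    have 1: "x ^ Suc n = x ^ a * x ^ Suc m"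
      by (simp add: n power_add mult_ac)
    have 2: "(if a = 0 then 0 else I (a - 1) * J (Suc n) a) = I a * (1 - x ^ a) * J (Suc n) a"
      using I_Suc[of "a - 1"] by (cases a) auto
    have 3: "J (Suc n) a = I (Suc m)" "J n a = I (Suc m) * (1 - x ^ Suc m)"
      using I_Suc[of m] by (simp_all add: J_def n Suc_diff_le)
    show ?thesis
      unfolding 2 unfolding 1 3 by (simp add: algebra_simps del: power_Suc)
  next
    case 2
    then show ?thesis
      using I_Suc[of n] by (simp add: J_def mult.commute)
  next
    case 3
    then show ?thesis by (simp add: J_def)
  qed
qed

private definition T :: "'a fps \<Rightarrow> nat \<Rightarrow> nat \<Rightarrow> 'a fps" where
  "T y n j = (\<Sum>a\<le>n. x ^ ((n - a) * (j - a)) * W y a * I a * J n a * J j a)"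

text \<open>The second half of \<open>J_rec\<close> is reindexed by \<open>a + 1\<close>. This turns
  \<open>W y (a + 1)\<close> into \<open>W (y * x) a\<close> up to the factor
  \<open>1 / (1 - y * x)\<close>, hence the parameters \<open>y * x\<close> and
  \<open>j - 1\<close>.\<close>

private lemma T_rec:
  "(1 - x ^ Suc n) * T y (Suc n) j =
     x ^ j * T y n j + (if j = 0 then 0 else inverse (1 - y * x) * T (y * x) n (j - 1))"
proof -
  let ?c = "\<lambda>a. x ^ ((Suc n - a) * (j - a)) * W y a * J j a"
  have "(1 - x ^ Suc n) * T y (Suc n) j = (\<Sum>a\<le>Suc n. ?c a * ((1 - x ^ Suc n) * I a * J (Suc n) a))"
    unfolding T_def sum_distrib_left by (intro sum.cong refl) (simp only: mult_ac)
  also have "\<dots> = (\<Sum>a\<le>Suc n. ?c a * (x ^ a * I a * J n a)) +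
      (\<Sum>a\<le>Suc n. ?c a * (if a = 0 then 0 else I (a - 1) * J (Suc n) a))"
    unfolding J_rec distrib_left sum.distrib ..
  also have "(\<Sum>a\<le>Suc n. ?c a * (x ^ a * I a * J n a)) = (\<Sum>a\<le>n. ?c a * (x ^ a * I a * J n a))"
    by (simp add: J_def)
  also have "\<dots> = x ^ j * T y n j"
    unfolding T_def sum_distrib_left
  proof (intro sum.cong refl)
    fix a assume a: "a \<in> {..n}"
    show "?c a * (x ^ a * I a * J n a)
        = x ^ j * (x ^ ((n - a) * (j - a)) * W y a * I a * J n a * J j a)"
    proof (cases "a \<le> j")
      case True
      then have "(Suc n - a) * (j - a) + a = j + (n - a) * (j - a)"
        using a by (simp add: Suc_diff_le)
      then have "x ^ ((Suc n - a) * (j - a)) * x ^ a = x ^ j * x ^ ((n - a) * (j - a))"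
        by (simp flip: power_add)
      moreover have "?c a * (x ^ a * I a * J n a) =
          (x ^ ((Suc n - a) * (j - a)) * x ^ a) * (W y a * I a * J n a * J j a)"
        by (simp only: mult_ac)
      ultimately show ?thesis
        by (simp only: mult.assoc)
    qed (simp add: J_def)
  qed
  also have "(\<Sum>a\<le>Suc n. ?c a * (if a = 0 then 0 else I (a - 1) * J (Suc n) a))
      = (\<Sum>a\<le>n. ?c (Suc a) * (I a * J (Suc n) (Suc a)))"
    by (subst sum.atMost_Suc_shift) simp
  also have "\<dots> = (if j = 0 then 0 else inverse (1 - y * x) * T (y * x) n (j - 1))"
  proof (cases j)
    case (Suc i)
    have "W y (Suc a) = inverse (1 - y * x) * W (y * x) a" for a
      unfolding qpochhammer_Suc_left by (simp add: fps_inverse_mult)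
    then show ?thesis
      unfolding T_def sum_distrib_left by (auto simp: Suc J_def mult_ac intro!: sum.cong)
  qed (simp add: J_def)
  finally show ?thesis .
qed

text \<open>By induction both terms of \<open>T_rec\<close> are multiples of one expression
  \<open>?R\<close>, with cofactors \<open>x ^ j * (1 - y * x ^ (n + 1))\<close> and
  \<open>1 - x ^ j\<close>. These add up to \<open>1 - y * x ^ (n + j + 1)\<close>, the next factor
  of the numerator.\<close>

private lemma T_eq: "T y n j = A y (n + j) * W y n * W y j * I n * I j"
proof (induction n arbitrary: y j)
  case 0
  have "A y j * W y j = 1"
    using x0 by (subst mult.commute) (intro inverse_mult_eq_1, simp add: qpochhammer_nth_0)
  then show ?case by (simp add: T_def J_def)
next
  case (Suc n)
  have yx: "(y * x) $ 0 = 0" using x0 by simp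
  let ?R = "A y (n + j) * W y (Suc n) * W y j * I n * I j"
  have Wn: "W y n = W y (Suc n) * (1 - y * x * x ^ n)"
    by (rule inverse_qpochhammer_Suc[OF yx])
  have "x ^ j * T y n j = ?R * (x ^ j * (1 - y * x * x ^ n))"
    unfolding Suc.IH Wn by (simp only: mult_ac)
  moreover have "(if j = 0 then 0 else inverse (1 - y * x) * T (y * x) n (j - 1)) = ?R * (1 - x ^ j)"
  proof (cases j)
    case (Suc i)
    have 1: "A y (n + j) = (1 - y * x) * A (y * x) (n + i)"
      by (simp add: Suc qpochhammer_Suc_left)
    have 2: "W y (Suc n) = inverse (1 - y * x) * W (y * x) n" "W y j = inverse (1 - y * x) * W (y * x) i"
      unfolding Suc qpochhammer_Suc_left by (simp_all add: fps_inverse_mult)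
    have 3: "I i = I j * (1 - x ^ j)"
      unfolding Suc using inverse_qpochhammer_Suc[OF x0, of x i] by simp
    have 4: "inverse (1 - y * x) * (1 - y * x) = 1"
      using x0 by (intro inverse_mult_eq_1) simp
    have "?R * (1 - x ^ j) = (inverse (1 - y * x) * (1 - y * x)) *
        (inverse (1 - y * x) * (A (y * x) (n + i) * W (y * x) n * W (y * x) i * I n * (I j * (1 - x ^ j))))"
      unfolding 1 2 by (simp only: mult_ac)
    also have "\<dots> = inverse (1 - y * x) * T (y * x) n i"
      unfolding 4 Suc.IH by (simp only: 3 mult_1_left)
    finally show ?thesis
      using Suc by simp
  qed simp
  ultimately have "(1 - x ^ Suc n) * T y (Suc n) j
      = ?R * (x ^ j * (1 - y * x * x ^ n) + (1 - x ^ j))"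
    unfolding T_rec by (simp only: distrib_left)
  also have "x ^ j * (1 - y * x * x ^ n) + (1 - x ^ j) = 1 - y * x * x ^ (n + j)"
    by (simp add: algebra_simps power_add)
  also have "?R * \<dots> = (1 - x ^ Suc n) * (A y (Suc n + j) * W y (Suc n) * W y j * I (Suc n) * I j)"
  proof -
    have "I n = I (Suc n) * (1 - x ^ Suc n)"
      using inverse_qpochhammer_Suc[OF x0, of x n] by simp
    moreover have "A y (Suc n + j) = A y (n + j) * (1 - y * x * x ^ (n + j))"
      by (simp add: qpochhammer_Suc)
    ultimately show ?thesis
      by (simp only: mult_ac)
  qed
  finally have "(1 - x ^ Suc n) * T y (Suc n) j =
      (1 - x ^ Suc n) * (A y (Suc n + j) * W y (Suc n) * W y j * I (Suc n) * I j)" .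
  moreover have "(1 - x ^ Suc n) $ 0 \<noteq> 0"
    using x0 by simp
  then have "1 - x ^ Suc n \<noteq> 0"
    by (metis fps_zero_nth)
  ultimately show ?case
    by (metis mult_left_cancel)
qed

text \<open>Only \<open>y = -1\<close> is needed, but the induction shifts \<open>y\<close> to \<open>y * x\<close>.\<close>

lemma q_chu_vandermonde:
  "(\<Sum>a\<le>min n j. x ^ ((n - a) * (j - a)) * inverse (qpochhammer (y * x) x a) *
      inverse (qpochhammer x x a) * inverse (qpochhammer x x (n - a)) * inverse (qpochhammer x x (j - a))) =
   qpochhammer (y * x) x (n + j) * inverse (qpochhammer (y * x) x n) * inverse (qpochhammer (y * x) x j) *
      inverse (qpochhammer x x n) * inverse (qpochhammer x x j)"
  unfolding T_eq[symmetric] T_def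
  by (rule sum.mono_neutral_cong_left) (auto simp: J_def)

end

lemma qpochhammer_square:
  fixes x :: "'a::comm_ring_1"
  shows "qpochhammer (x\<^sup>2) (x\<^sup>2) n = qpochhammer x x n * qpochhammer (- x) x n"
  by (induction n) (auto simp: qpochhammer_Suc algebra_simps power2_eq_square power_mult_distrib)

text \<open>At \<open>y = -1\<close> the denominators \<open>(x; x)_a\<close> and
  \<open>(-x; x)_a\<close> merge by \<open>qpochhammer_square\<close>, which matches the base
  \<open>q ^ (2 * t)\<close> that belongs to \<open>a\<close> in the quadruple series.\<close>

lemma pair_sum:
  fixes x :: "'a::field fps"
  assumes "x $ 0 = 0"
  shows "(\<Sum>a\<le>min n j. x ^ ((n - a) * (j - a)) * inverse (qpochhammer (x\<^sup>2) (x\<^sup>2) a) *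
      inverse (qpochhammer x x (n - a)) * inverse (qpochhammer x x (j - a))) =
    qpochhammer (- x) x (n + j) * inverse (qpochhammer (x\<^sup>2) (x\<^sup>2) n) * inverse (qpochhammer (x\<^sup>2) (x\<^sup>2) j)"
  using q_chu_vandermonde[OF assms, of n j "-1"]
  by (simp add: qpochhammer_square fps_inverse_mult mult_ac)

subsection \<open>The double series and its recurrences\<close>

lemma fps_nth_X_power_mult_0:
  "n < k \<Longrightarrow> (fps_X ^ k * f :: 'a::comm_ring_1 fps) $ n = 0"
  by (simp add: fps_X_power_mult_nth)

text \<open>The product of \<open>1 + q ^ (t * k)\<close> over \<open>k > m\<close>, in the form in
  which the sum over \<open>b\<close> produces it; \<open>distinct_upto\<close> is the complementary
  product over \<open>1 <= k <= m\<close>.\<close>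

definition distinct_tail :: "nat \<Rightarrow> nat \<Rightarrow> rat fps" where
  "distinct_tail t m = euler_sum (fps_X ^ (t * Suc m)) (fps_X ^ t)"

definition distinct_upto :: "nat \<Rightarrow> nat \<Rightarrow> rat fps" where
  "distinct_upto t m = qpochhammer (- (fps_X ^ t)) (fps_X ^ t) m"

definition inv_even :: "nat \<Rightarrow> nat \<Rightarrow> rat fps" where
  "inv_even t n = inverse (qpochhammer (fps_X ^ (2 * t)) (fps_X ^ (2 * t)) n)"

text \<open>At \<open>N = 0\<close> the exponent is the least sum of \<open>i\<close> distinct parts
  congruent to \<open>t + 1\<close> and \<open>j\<close> distinct parts congruent to
  \<open>t - 1\<close> modulo \<open>2 * t\<close>; \<open>N\<close> adds \<open>t * N\<close> to
  each of these parts.\<close>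

definition pair_mon :: "nat \<Rightarrow> nat \<Rightarrow> nat \<Rightarrow> nat \<Rightarrow> rat fps" where
  "pair_mon t N i j = fps_X ^ (t * i\<^sup>2 + i + (t * j\<^sup>2 - j) + t * N * (i + j))"

text \<open>With \<open>x = q ^ t\<close>, the sum of \<open>lower_term t N (i, j)\<close> over \<open>i, j\<close> counts the partitions of
  the sum class with all parts at least \<open>t * (N + 1) - 1\<close>, and that of \<open>mid_term\<close> those with all
  parts at least \<open>t * (N + 1)\<close>. The first term comes from summing the quadruple series over \<open>b\<close>
  and over \<open>a\<close> with \<open>i = a + d\<close>, \<open>j = a + c\<close> fixed; the factor in the second one
  was found by solving the recurrences for small \<open>i, j\<close>.\<close>

definition lower_term :: "nat \<Rightarrow> nat \<Rightarrow> nat \<times> nat \<Rightarrow> rat fps" where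
  "lower_term t N = (\<lambda>(i, j). pair_mon t N i j * (distinct_tail t (N + (i + j)) *
     distinct_upto t (i + j) * inv_even t i * inv_even t j))"

definition mid_term :: "nat \<Rightarrow> nat \<Rightarrow> nat \<times> nat \<Rightarrow> rat fps" where
  "mid_term t N = (\<lambda>(i, j). lower_term t N (i, j) *
     (fps_X ^ (t * j) * (fps_X ^ (t * i) + fps_X ^ (t * j)) * inverse (1 + fps_X ^ (t * (i + j)))))"

definition lower_sum :: "nat \<Rightarrow> nat \<Rightarrow> rat fps" where
  "lower_sum t N = (\<Sum>\<^sub>\<infinity>k. lower_term t N k)"

definition mid_sum :: "nat \<Rightarrow> nat \<Rightarrow> rat fps" where
  "mid_sum t N = (\<Sum>\<^sub>\<infinity>k. mid_term t N k)"

context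
  fixes t :: nat
  assumes t: "t > 1"
begin

lemma distinct_tail_rec:
  "distinct_tail t m = (1 + fps_X ^ (t * Suc m)) * distinct_tail t (Suc m)"
  unfolding distinct_tail_def
  using t euler_sum_rec[of "fps_X ^ (t * Suc m)" "fps_X ^ t :: rat fps"]
  by (simp flip: power_add add: add.commute)

lemma distinct_tail_0: "distinct_tail t 0 = distinct_upto t m * distinct_tail t m"
  unfolding distinct_tail_def distinct_upto_def
  using t euler_sum_eq_prod[of "fps_X ^ t" "fps_X ^ t :: rat fps" m]
  by (simp flip: power_add power_mult)

lemma distinct_upto_Suc: "distinct_upto t (Suc m) = distinct_upto t m * (1 + fps_X ^ (t * Suc m))"
  by (simp add: distinct_upto_def qpochhammer_Suc power_add power_mult)

lemma inv_even_eq: "inv_even t n = inv_even t (Suc n) * (1 - fps_X ^ (t * Suc n) * fps_X ^ (t * Suc n))"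
proof -
  have "2 * t + 2 * t * n = t * Suc n + t * Suc n"
    by simp
  then show ?thesis
    unfolding inv_even_def
    using t inverse_qpochhammer_Suc[of "fps_X ^ (2 * t)" "fps_X ^ (2 * t) :: rat fps" n]
    by (simp flip: power_add power_mult)
qed

lemma minus_exponent_Suc: "t * (Suc j)\<^sup>2 - Suc j = (t * j\<^sup>2 - j) + 2 * t * j + (t - 1)"
proof -
  have "1 * j \<le> t * (j * j)"
    using t by (intro mult_le_mono le_square) auto
  then obtain m where m: "t * j\<^sup>2 = j + m"
    by (auto simp: power2_eq_square le_iff_add)
  have "t * (Suc j)\<^sup>2 = t * j\<^sup>2 + 2 * t * j + t"
    by (simp add: power2_eq_square algebra_simps)
  then show ?thesis
    unfolding m using t by simp
qed

text \<open>Bounds \<open>j\<close> by the exponent of \<open>pair_mon\<close>, so that only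
  finitely many pairs reach a given coefficient.\<close>

lemma minus_exponent_ge: "j \<le> t * j\<^sup>2 - j"
proof -
  have "2 * j \<le> t * (j * j)"
    using t by (intro mult_le_mono le_square) auto
  then have "j + j \<le> t * j\<^sup>2"
    by (simp only: power2_eq_square mult_2)
  then show ?thesis
    by (rule add_le_imp_le_diff)
qed

lemma inverse_1_plus:
  fixes f :: "rat fps"
  shows "f = f * (1 + fps_X ^ n) * inverse (1 + fps_X ^ n)"
proof -
  \<comment> \<open>For \<open>n = 0\<close> the constant coefficient is 2, still a unit. This case
    occurs at \<open>i = j = 0\<close>, where the extra factor of \<open>mid_term\<close> is
    \<open>(1 + 1) / 2 = 1\<close>.\<close>
  have "inverse (1 + fps_X ^ n) * (1 + fps_X ^ n :: rat fps) = 1"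
    by (intro inverse_mult_eq_1) (cases n, auto)
  then show ?thesis
    by (simp add: mult.assoc mult.commute)
qed

text \<open>After the common factor \<open>K\<close> is taken out, this is \<open>(1 + y*u*v)*v*(u +
  v) = u*v*(1 + u*v) + v*v*(1 - u*u) + y*u*v*v*(u + v)\<close>. On partitions the three terms are
  the cases of a smallest part above \<open>t * Suc N + 1\<close> (or none), equal to it, and equal
  to \<open>t * Suc N\<close>.\<close>

lemma mid_term_rec:
  "mid_term t N (i, j) = lower_term t (Suc N) (i, j) +
     fps_X ^ (t * Suc N + 1) * (if i = 0 then 0 else lower_term t (Suc (Suc N)) (i - 1, j)) +
     fps_X ^ (t * Suc N) * mid_term t (Suc N) (i, j)"
proof -
  define K where "K = distinct_tail t (Suc (N + (i + j))) * distinct_upto t (i + j) *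
    pair_mon t N i j * inv_even t i * inv_even t j"
  define u v y :: "rat fps" where "u = fps_X ^ (t * i)" and "v = fps_X ^ (t * j)"
    and "y = fps_X ^ (t * Suc N)"
  define r where "r = inverse (1 + u * v)"
  have uv: "fps_X ^ (t * (i + j)) = u * v"
    by (simp add: u_def v_def power_add distrib_left)
  have r: "f = f * (1 + u * v) * r" for f
    using inverse_1_plus[of f "t * (i + j)"] by (simp add: uv r_def)
  have yuv: "fps_X ^ (t * Suc (N + (i + j))) = y * (u * v)"
    by (simp add: u_def v_def y_def algebra_simps flip: power_add)
  have "pair_mon t (Suc N) i j = pair_mon t N i j * (u * v)"
    by (simp add: pair_mon_def u_def v_def algebra_simps flip: power_add)
  then have 1: "lower_term t (Suc N) (i, j) = K * (u * v)"
    by (simp add: lower_term_def K_def mult_ac)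
  have 2: "mid_term t (Suc N) (i, j) = K * (u * v) * (v * (u + v)) * r"
    unfolding mid_term_def prod.case uv 1 by (simp add: u_def v_def r_def mult_ac)
  have "lower_term t N (i, j) = K * (1 + y * (u * v))"
    unfolding lower_term_def K_def prod.case distinct_tail_rec[of "N + (i + j)"] yuv
    by (simp only: mult_ac)
  then have 3: "mid_term t N (i, j) = K * (1 + y * (u * v)) * (v * (u + v)) * r"
    unfolding mid_term_def prod.case uv by (simp add: u_def v_def r_def mult_ac)
  have 4: "fps_X ^ (t * Suc N + 1) * (if i = 0 then 0 else lower_term t (Suc (Suc N)) (i - 1, j))
      = K * (v * v) * (1 - u * u) * r"
  proof (cases i)
    case 0
    \<comment> \<open>Here \<open>u = 1\<close>, so \<open>1 - u * u\<close> vanishes, in agreement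
      with the default value 0.\<close>
    then show ?thesis by (simp add: u_def)
  next
    case (Suc k)
    have a: "inv_even t k = inv_even t i * (1 - u * u)"
      using inv_even_eq[of k] by (simp only: u_def Suc)
    \<comment> \<open>The factor gained by \<open>distinct_upto\<close> from
      \<open>i + j - 1\<close> to \<open>i + j\<close> is exactly the denominator in
      \<open>mid_term\<close>.\<close>
    have b: "distinct_upto t (k + j) = distinct_upto t (i + j) * r"
      using distinct_upto_Suc[of "k + j"] r[of "distinct_upto t (k + j)"] uv by (simp add: Suc)
    have c: "fps_X ^ (t * Suc N + 1) * pair_mon t (Suc (Suc N)) k j = pair_mon t N i j * (v * v)"
      by (simp add: Suc pair_mon_def v_def algebra_simps power2_eq_square flip: power_add)
    have d: "distinct_tail t (Suc (Suc N) + (k + j)) = distinct_tail t (Suc (N + (i + j)))"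
      by (simp add: Suc)
    have "fps_X ^ (t * Suc N + 1) * lower_term t (Suc (Suc N)) (k, j) =
        (fps_X ^ (t * Suc N + 1) * pair_mon t (Suc (Suc N)) k j) *
        (distinct_tail t (Suc (N + (i + j))) * (distinct_upto t (i + j) * r) *
          (inv_even t i * (1 - u * u)) * inv_even t j)"
      unfolding lower_term_def prod.case a b d by (simp only: mult.assoc)
    then show ?thesis
      unfolding c K_def using Suc by (simp add: mult_ac)
  qed
  have "K * (1 + y * (u * v)) * (v * (u + v)) * r = K * (u * v) * (1 + u * v) * r +
      K * (v * v) * (1 - u * u) * r + y * (K * (u * v) * (v * (u + v)) * r)"
    by (simp add: algebra_simps)
  then show ?thesis
    unfolding 1 2 3 4 y_def[symmetric] by (simp only: r[of "K * (u * v)", symmetric])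
qed

text \<open>Two splittings. First \<open>1 + u*v = v*(u + v) + (1 - v*v)\<close> separates
  \<open>mid_term\<close> from a remainder \<open>P\<close>, where \<open>1 - v*v\<close> lowers the
  index \<open>j\<close> of \<open>inv_even\<close>. Then
  \<open>1 + u*w = u*(u + w) + (1 - u*u)\<close>, with \<open>w\<close> belonging to
  \<open>j - 1\<close>, divides \<open>P\<close> according to whether the part
  \<open>t * Suc N - 1\<close> is accompanied by \<open>t * Suc N + 1\<close>.\<close>

lemma lower_term_rec:
  "lower_term t N (i, j) = mid_term t N (i, j) +
     fps_X ^ (t * Suc N - 1) * (if j = 0 then 0 else mid_term t (Suc N) (i, j - 1)) +
     fps_X ^ (2 * t * Suc N) *
       (if i = 0 \<or> j = 0 then 0 else lower_term t (Suc (Suc N)) (i - 1, j - 1))"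
proof -
  define u v :: "rat fps" where "u = fps_X ^ (t * i)" and "v = fps_X ^ (t * j)"
  define r where "r = inverse (1 + u * v)"
  have uv: "fps_X ^ (t * (i + j)) = u * v"
    by (simp add: u_def v_def power_add distrib_left)
  have r: "f = f * (1 + u * v) * r" for f
    using inverse_1_plus[of f "t * (i + j)"] by (simp add: uv r_def)
  have "lower_term t N (i, j) = lower_term t N (i, j) * (1 + u * v) * r"
    by (rule r)
  moreover have "mid_term t N (i, j) = lower_term t N (i, j) * (v * (u + v)) * r"
    unfolding mid_term_def prod.case uv by (simp add: u_def v_def r_def mult_ac)
  ultimately have split: "lower_term t N (i, j) = mid_term t N (i, j) + lower_term t N (i, j) * (1 - v * v) * r"
    by (simp only:) (simp add: algebra_simps)
  show ?thesis
  proof (cases j)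
    case 0
    then show ?thesis using split by (simp add: v_def)
  next
    case (Suc k)
    define w :: "rat fps" where "w = fps_X ^ (t * k)"
    define s where "s = inverse (1 + u * w)"
    have uw: "fps_X ^ (t * (i + k)) = u * w"
      by (simp add: u_def w_def power_add distrib_left)
    have s: "f = f * (1 + u * w) * s" for f
      using inverse_1_plus[of f "t * (i + k)"] by (simp add: uw s_def)
    define P where "P = distinct_tail t (Suc (N + (i + k))) * distinct_upto t (i + k) *
      pair_mon t N i j * inv_even t i * inv_even t k"
    have a: "inv_even t k = inv_even t j * (1 - v * v)"
      using inv_even_eq[of k] by (simp only: v_def Suc)
    have b: "distinct_upto t (i + k) = distinct_upto t (i + j) * r"
      using distinct_upto_Suc[of "i + k"] r[of "distinct_upto t (i + k)"] uv by (simp add: Suc)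
    have 1: "lower_term t N (i, j) * (1 - v * v) * r = P"
      unfolding P_def a b lower_term_def prod.case by (simp add: Suc mult_ac)
    have c: "fps_X ^ (t * Suc N - 1) * pair_mon t (Suc N) i k * w = pair_mon t N i j * u"
    proof -
      define m where "m = t * k\<^sup>2 - k"
      obtain t' where t': "t = Suc t'" using t by (cases t) auto
      show ?thesis
        unfolding pair_mon_def Suc minus_exponent_Suc m_def[symmetric] w_def u_def
        by (simp add: t' algebra_simps flip: power_add)
    qed
    have 2: "fps_X ^ (t * Suc N - 1) * mid_term t (Suc N) (i, k) = P * (u * (u + w)) * s"
    proof -
      have "fps_X ^ (t * Suc N - 1) * mid_term t (Suc N) (i, k) =
        (fps_X ^ (t * Suc N - 1) * pair_mon t (Suc N) i k * w) *
        (distinct_tail t (Suc (N + (i + k))) * distinct_upto t (i + k) * inv_even t i *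
          inv_even t k * (u + w) * s)"
        unfolding mid_term_def lower_term_def prod.case uw s_def
        by (simp add: u_def w_def mult_ac)
      then show ?thesis
        unfolding c P_def by (simp only: mult_ac)
    qed
    have 3: "fps_X ^ (2 * t * Suc N) * (if i = 0 then 0 else lower_term t (Suc (Suc N)) (i - 1, k))
        = P * (1 - u * u) * s"
    proof (cases i)
      case 0
      then show ?thesis by (simp add: u_def)
    next
      case i: (Suc l)
      have d: "inv_even t l = inv_even t i * (1 - u * u)"
        using inv_even_eq[of l] by (simp only: u_def i)
      have e: "distinct_upto t (l + k) = distinct_upto t (i + k) * s"
        using distinct_upto_Suc[of "l + k"] s[of "distinct_upto t (l + k)"] uw by (simp add: i)
      have f: "distinct_tail t (Suc (Suc N) + (l + k)) = distinct_tail t (Suc (N + (i + k)))"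
        by (simp add: i)
      have g: "fps_X ^ (2 * t * Suc N) * pair_mon t (Suc (Suc N)) l k = pair_mon t N i j"
      proof -
        define m where "m = t * k\<^sup>2 - k"
        obtain t' where t': "t = Suc t'" using t by (cases t) auto
        show ?thesis
          unfolding pair_mon_def Suc i minus_exponent_Suc m_def[symmetric]
          by (simp add: t' algebra_simps power2_eq_square flip: power_add)
      qed
      have "fps_X ^ (2 * t * Suc N) * lower_term t (Suc (Suc N)) (l, k) =
        (fps_X ^ (2 * t * Suc N) * pair_mon t (Suc (Suc N)) l k) *
        (distinct_tail t (Suc (N + (i + k))) * (distinct_upto t (i + k) * s) *
          (inv_even t i * (1 - u * u)) * inv_even t k)"
        unfolding lower_term_def prod.case d e f by (simp only: mult.assoc)
      then show ?thesis
        unfolding g P_def using i by (simp add: mult_ac)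
    qed
    have "P = P * (1 + u * w) * s"
      by (rule s)
    then have "P = P * (u * (u + w)) * s + P * (1 - u * u) * s"
      by (simp add: algebra_simps)
    then show ?thesis
      using split Suc unfolding 1 2[symmetric] 3[symmetric] by (simp add: add.assoc)
  qed
qed

lemma lower_term_nth_0:
  assumes "n < i \<or> n < j"
  shows "lower_term t N (i, j) $ n = 0"
proof -
  have "n < t * i\<^sup>2 + i + (t * j\<^sup>2 - j) + t * N * (i + j)"
    using assms minus_exponent_ge[of j] by linarith
  then show ?thesis
    by (simp add: lower_term_def pair_mon_def fps_nth_X_power_mult_0)
qed

lemma mid_term_nth_0:
  assumes "\<And>m. m \<le> n \<Longrightarrow> lower_term t N (i, j) $ m = 0"
  shows "mid_term t N (i, j) $ n = 0"
  unfolding mid_term_def prod.case by (intro fps_mult_nth_0_left assms)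

lemma has_sum_lower: "(lower_term t N has_sum lower_sum t N) UNIV"
  unfolding lower_sum_def
proof (intro has_sum_infsum summable_on_fpsI)
  fix n
  have "{k \<in> UNIV. lower_term t N k $ n \<noteq> 0} \<subseteq> {..n} \<times> {..n}"
    using lower_term_nth_0[of n] by (auto simp: not_less[symmetric])
  then show "finite {k \<in> UNIV. lower_term t N k $ n \<noteq> 0}"
    by (rule finite_subset) simp
qed

lemma has_sum_mid: "(mid_term t N has_sum mid_sum t N) UNIV"
  unfolding mid_sum_def
proof (intro has_sum_infsum summable_on_fpsI)
  fix n
  have "mid_term t N (i, j) $ n = 0" if "n < i \<or> n < j" for i j
    using that by (intro mid_term_nth_0 lower_term_nth_0) linarith
  then have "{k \<in> UNIV. mid_term t N k $ n \<noteq> 0} \<subseteq> {..n} \<times> {..n}"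
    by (auto simp: not_less[symmetric])
  then show "finite {k \<in> UNIV. mid_term t N k $ n \<noteq> 0}"
    by (rule finite_subset) simp
qed

lemma lower_sum_rec:
  "lower_sum t N = mid_sum t N + fps_X ^ (t * Suc N - 1) * mid_sum t (Suc N) +
     fps_X ^ (2 * t * Suc N) * lower_sum t (Suc (Suc N))"
proof (rule has_sum_unique[OF has_sum_lower])
  have "((\<lambda>(i, j). if j = 0 then 0 else mid_term t (Suc N) (i, j - 1)) has_sum mid_sum t (Suc N)) UNIV"
    by (rule has_sum_inj_extend[OF has_sum_mid, of "\<lambda>(i, j). (i, Suc j)"])
      (auto simp: inj_def image_iff gr0_conv_Suc)
  moreover have "((\<lambda>(i, j). if i = 0 \<or> j = 0 then 0 else lower_term t (Suc (Suc N)) (i - 1, j - 1))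
      has_sum lower_sum t (Suc (Suc N))) UNIV"
    by (rule has_sum_inj_extend[OF has_sum_lower, of "\<lambda>(i, j). (Suc i, Suc j)"])
      (auto simp: inj_def image_iff gr0_conv_Suc)
  ultimately show "(lower_term t N has_sum mid_sum t N + fps_X ^ (t * Suc N - 1) * mid_sum t (Suc N) +
     fps_X ^ (2 * t * Suc N) * lower_sum t (Suc (Suc N))) UNIV"
    by (subst has_sum_cong[OF lower_term_rec[of N "fst k" "snd k" for k, unfolded prod.collapse]])
      (intro has_sum_add has_sum_cmult_right has_sum_mid; simp add: case_prod_unfold)
qed

lemma mid_sum_rec:
  "mid_sum t N = lower_sum t (Suc N) + fps_X ^ (t * Suc N + 1) * lower_sum t (Suc (Suc N)) +
     fps_X ^ (t * Suc N) * mid_sum t (Suc N)"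
proof (rule has_sum_unique[OF has_sum_mid])
  have "((\<lambda>(i, j). if i = 0 then 0 else lower_term t (Suc (Suc N)) (i - 1, j))
      has_sum lower_sum t (Suc (Suc N))) UNIV"
    by (rule has_sum_inj_extend[OF has_sum_lower, of "\<lambda>(i, j). (Suc i, j)"])
      (auto simp: inj_def image_iff gr0_conv_Suc)
  then show "(mid_term t N has_sum lower_sum t (Suc N) +
     fps_X ^ (t * Suc N + 1) * lower_sum t (Suc (Suc N)) +
     fps_X ^ (t * Suc N) * mid_sum t (Suc N)) UNIV"
    by (subst has_sum_cong[OF mid_term_rec[of N "fst k" "snd k" for k, unfolded prod.collapse]])
      (intro has_sum_add has_sum_cmult_right has_sum_mid has_sum_lower; simp add: case_prod_unfold)
qed

text \<open>The boundary condition for large \<open>N\<close>: terms away from \<open>(0, 0)\<close>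
  contain \<open>q ^ (t * N * (i + j))\<close>, and at \<open>(0, 0)\<close> only
  \<open>distinct_tail t N\<close> remains, which differs from 1 in degrees above \<open>N\<close>
  only.\<close>

lemma pair_sums_nth:
  assumes "n < N"
  shows "lower_sum t N $ n = (if n = 0 then 1 else 0)" "mid_sum t N $ n = (if n = 0 then 1 else 0)"
proof -
  have 0: "lower_term t N (i, j) $ m = 0" if "(i, j) \<noteq> (0, 0)" "m < N" for m i j
  proof -
    have "1 * N * 1 \<le> t * N * (i + j)"
      using that t by (intro mult_le_mono) auto
    then have "m < t * i\<^sup>2 + i + (t * j\<^sup>2 - j) + t * N * (i + j)"
      using \<open>m < N\<close> by linarith
    then show ?thesis
      by (simp add: lower_term_def pair_mon_def fps_nth_X_power_mult_0)
  qed
  have tail: "distinct_tail t N $ n = (if n = 0 then 1 else 0)"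
    unfolding distinct_tail_def
  proof (rule euler_sum_nth)
    have "1 * Suc N \<le> t * Suc N"
      using t by (intro mult_le_mono) auto
    then show "(fps_X ^ (t * Suc N) :: rat fps) $ m = 0" if "m \<le> n" for m
      using that assms by (simp add: fps_X_power_nth)
  qed
  have 1: "lower_term t N k $ n = 0" "mid_term t N k $ n = 0" if "k \<noteq> (0, 0)" for k
    using 0[of "fst k" "snd k"] that assms mid_term_nth_0[of n N "fst k" "snd k"]
    by (auto simp: prod_eq_iff)
  have "lower_sum t N $ n = lower_term t N (0, 0) $ n"
    by (rule has_sum_fps_nth_eq[OF has_sum_lower]) (use 1 in auto)
  then show "lower_sum t N $ n = (if n = 0 then 1 else 0)"
    using tail by (simp add: lower_term_def pair_mon_def distinct_upto_def inv_even_def)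
  have "mid_sum t N $ n = mid_term t N (0, 0) $ n"
    by (rule has_sum_fps_nth_eq[OF has_sum_mid]) (use 1 in auto)
  moreover have "mid_term t N (0, 0) = lower_term t N (0, 0)"
    using inverse_1_plus[of "lower_term t N (0, 0)" 0] by (simp add: mid_term_def mult_ac)
  ultimately show "mid_sum t N $ n = (if n = 0 then 1 else 0)"
    using tail by (simp add: lower_term_def pair_mon_def distinct_upto_def inv_even_def)
qed

end

text \<open>Each equation refers to larger \<open>N\<close>, except that \<open>f N\<close> refers
  to \<open>g N\<close>; so \<open>g\<close> comes first at every stage. The induction is on
  \<open>k\<close> with \<open>n < N + k\<close>, for all coefficients up to \<open>n\<close> at
  once because products mix them.\<close>

lemma fps_recurrence_unique:
  fixes f g f' g' :: "nat \<Rightarrow> 'a::comm_ring_1 fps"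
  assumes f: "\<And>N. f N = g N + a N * g (Suc N) + b N * f (Suc (Suc N))"
    and g: "\<And>N. g N = f (Suc N) + c N * f (Suc (Suc N)) + d N * g (Suc N)"
    and f': "\<And>N. f' N = g' N + a N * g' (Suc N) + b N * f' (Suc (Suc N))"
    and g': "\<And>N. g' N = f' (Suc N) + c N * f' (Suc (Suc N)) + d N * g' (Suc N)"
    and lim: "\<And>N n. n < N \<Longrightarrow> f N $ n = f' N $ n" "\<And>N n. n < N \<Longrightarrow> g N $ n = g' N $ n"
  shows "f N = f' N"
proof (rule fps_ext)
  fix n
  have "\<forall>m\<le>n. f N $ m = f' N $ m \<and> g N $ m = g' N $ m" if "n < N + k" for k N
    using that
  proof (induction k arbitrary: N rule: less_induct)
    case (less k)
    show ?case
    proof (cases k)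
      case 0
      then show ?thesis using less.prems lim by auto
    next
      case (Suc k')
      have 1: "f (Suc N) $ m = f' (Suc N) $ m" "g (Suc N) $ m = g' (Suc N) $ m" if "m \<le> n" for m
        using less.IH[of k' "Suc N"] less.prems that Suc by auto
      \<comment> \<open>The jump by two can use the same \<open>k'\<close>:
        \<open>n < N + Suc k'\<close> implies \<open>n < Suc (Suc N) + k'\<close>.\<close>
      have 2: "f (Suc (Suc N)) $ m = f' (Suc (Suc N)) $ m" if "m \<le> n" for m
        using less.IH[of k' "Suc (Suc N)"] less.prems that Suc by auto
      have 3: "g N $ m = g' N $ m" if "m \<le> n" for m
        by (subst g, subst g') (use 1 2 that in \<open>auto simp: fps_mult_nth\<close>)
      have "f N $ m = f' N $ m" if "m \<le> n" for m
        by (subst f, subst f') (use 1 2 3 that in \<open>auto simp: fps_mult_nth\<close>)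
      with 3 show ?thesis by blast
    qed
  qed
  from this[of N "Suc n"] show "f N $ n = f' N $ n" by auto
qed

subsection \<open>The quadruple sum\<close>

lemma two_choose_two: "2 * (n choose 2) + n = n\<^sup>2"
  by (induction n) (simp_all add: numeral_2_eq_2)

context
  fixes t :: nat
  assumes t: "t > 1"
begin

text \<open>With \<open>i = a + d\<close> and \<open>j = a + c\<close>, the variable
  \<open>b\<close> enters only as in an Euler series with \<open>y = q ^ (t * (1 + i + j))\<close>,
  and the remaining cross term \<open>d * c = (i - a) * (j - a)\<close> is the exponent in
  \<open>pair_sum\<close>.\<close>

lemma sum_exponent_eq:
  "sum_exponent t a b c d = t * (a + d)\<^sup>2 + (a + d) + (t * (a + c)\<^sup>2 - (a + c)) + t * (d * c) +
     (t * Suc ((a + d) + (a + c)) * b + t * (b choose 2))"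
proof -
  have le: "a + c \<le> t * (a + c)\<^sup>2"
    using minus_exponent_ge[OF t, of "a + c"] by linarith
  have "2 * real (b choose 2) + real b = (real b)\<^sup>2"
    using two_choose_two[of b] by (metis of_nat_add of_nat_mult of_nat_numeral of_nat_power)
  then have b: "real (b choose 2) = ((real b)\<^sup>2 - real b) / 2"
    by simp
  have ac: "real (t * (a + c)\<^sup>2 - (a + c)) = real t * (real a + real c)\<^sup>2 - (real a + real c)"
    using le by (subst of_nat_diff) auto
  have "real (sum_exponent t a b c d) = real (t * (a + d)\<^sup>2 + (a + d)) +
      real (t * (a + c)\<^sup>2 - (a + c)) + real (t * (d * c) + (t * Suc ((a + d) + (a + c)) * b + t * (b choose 2)))"
    unfolding ac using t by (simp add: real_sum_exponent Q_def b field_simps power2_eq_square)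
  also have "\<dots> = real (t * (a + d)\<^sup>2 + (a + d) + (t * (a + c)\<^sup>2 - (a + c)) +
      t * (d * c) + (t * Suc ((a + d) + (a + c)) * b + t * (b choose 2)))"
    by (simp only: of_nat_add add.assoc)
  finally have "real (sum_exponent t a b c d) = real (t * (a + d)\<^sup>2 + (a + d) + (t * (a + c)\<^sup>2 - (a + c)) +
      t * (d * c) + (t * Suc ((a + d) + (a + c)) * b + t * (b choose 2)))" .
  then show ?thesis
    by (simp only: of_nat_eq_iff)
qed

definition triple_term :: "nat \<times> nat \<times> nat \<Rightarrow> rat fps" where
  "triple_term = (\<lambda>(a, c, d). pair_mon t 0 (a + d) (a + c) * ((fps_X ^ t) ^ (d * c) * inv_even t a *
     inverse (qpochhammer (fps_X ^ t) (fps_X ^ t) d) * inverse (qpochhammer (fps_X ^ t) (fps_X ^ t) c)))"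

lemma sum_term_eq:
  "sum_term t (a, b, c, d) = triple_term (a, c, d) *
     euler_term (fps_X ^ (t * Suc ((a + d) + (a + c)))) (fps_X ^ t) b"
proof -
  have "(fps_X ^ sum_exponent t a b c d :: rat fps) = pair_mon t 0 (a + d) (a + c) * (fps_X ^ t) ^ (d * c) *
      ((fps_X ^ (t * Suc ((a + d) + (a + c)))) ^ b * (fps_X ^ t) ^ (b choose 2))"
    unfolding sum_exponent_eq pair_mon_def
    by (simp only: power_add[symmetric] power_mult[symmetric] mult_0_right mult_0 add_0_right)
  then show ?thesis
    unfolding sum_term_def triple_term_def prod.case euler_term_def inv_even_def
    using t by (simp add: fps_divide_unit qpochhammer_nth_0 fps_inverse_mult mult_ac)
qed

lemma triple_term_nth_0: "n < a \<or> n < c \<or> n < d \<Longrightarrow> m \<le> n \<Longrightarrow> (triple_term (a, c, d) * f) $ m = 0"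
proof -
  assume "n < a \<or> n < c \<or> n < d" "m \<le> n"
  then have "m < t * (a + d)\<^sup>2 + (a + d) + (t * (a + c)\<^sup>2 - (a + c)) + t * 0 * ((a + d) + (a + c))"
    using minus_exponent_ge[OF t, of "a + c"] by linarith
  then show ?thesis
    unfolding triple_term_def prod.case pair_mon_def mult.assoc[of "fps_X ^ _"]
    by (rule fps_nth_X_power_mult_0)
qed

lemma summable_sum_term: "sum_term t summable_on UNIV"
proof (rule summable_on_fpsI)
  fix n
  have "sum_term t (a, b, c, d) $ n = 0" if "n < a \<or> n < b \<or> n < c \<or> n < d" for a b c d
  proof (cases "n < b")
    case True
    have "sum_term t (a, b, c, d) $ n =
        (euler_term (fps_X ^ (t * Suc ((a + d) + (a + c)))) (fps_X ^ t) b * triple_term (a, c, d)) $ n"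
      by (simp add: sum_term_eq mult.commute)
    also have "\<dots> = 0"
      by (intro fps_mult_nth_0_left euler_term_nth_0) (use True t in auto)
    finally show ?thesis .
  next
    case False
    then show ?thesis
      unfolding sum_term_eq using that by (intro triple_term_nth_0) auto
  qed
  then have "{k \<in> UNIV. sum_term t k $ n \<noteq> 0} \<subseteq> {..n} \<times> {..n} \<times> {..n} \<times> {..n}"
    by (auto simp: not_less[symmetric])
  then show "finite {k \<in> UNIV. sum_term t k $ n \<noteq> 0}"
    by (rule finite_subset) simp
qed

text \<open>The triples are grouped by \<open>(i, j) = (a + d, a + c)\<close>; each group is finite,
  with \<open>a <= min i j\<close>, and is summed by \<open>pair_sum\<close>.\<close>

lemma has_sum_triple:
  "((\<lambda>(a, c, d). triple_term (a, c, d) * distinct_tail t ((a + d) + (a + c))) has_sum lower_sum t 0) UNIV"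
proof -
  define h where "h = (\<lambda>((i, j), a). triple_term (a, j - a, i - a) * distinct_tail t (i + j))"
  let ?B = "\<lambda>(i, j). {..min i j :: nat}"
  have "(h has_sum lower_sum t 0) (Sigma UNIV ?B)"
  proof (rule has_sum_SigmaI[OF _ has_sum_lower[OF t]])
    fix k :: "nat \<times> nat"
    obtain i j where k: "k = (i, j)" by force
    let ?x = "fps_X ^ t :: rat fps"
    have "(\<Sum>a\<le>min i j. h ((i, j), a)) = pair_mon t 0 i j * distinct_tail t (i + j) *
      (\<Sum>a\<le>min i j. ?x ^ ((i - a) * (j - a)) * inverse (qpochhammer (?x\<^sup>2) (?x\<^sup>2) a) *
        inverse (qpochhammer ?x ?x (i - a)) * inverse (qpochhammer ?x ?x (j - a)))"
      unfolding sum_distrib_left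
      by (intro sum.cong refl)
        (simp add: h_def triple_term_def inv_even_def mult_ac flip: power_mult)
    also have "\<dots> = lower_term t 0 (i, j)"
      using t by (subst pair_sum)
        (simp_all add: lower_term_def inv_even_def distinct_upto_def mult_ac flip: power_mult)
    finally show "((\<lambda>a. h (k, a)) has_sum lower_term t 0 k) (?B k)"
      unfolding k by (intro has_sum_finiteI) auto
  next
    show "h summable_on Sigma UNIV ?B"
    proof (rule summable_on_fpsI)
      fix n
      have "h ((i, j), a) $ n = 0" if "a \<le> min i j" "n < i \<or> n < j" for i j a
      proof -
        have "n < t * i\<^sup>2 + i + (t * j\<^sup>2 - j) + t * 0 * (i + j)"
          using that minus_exponent_ge[OF t, of j] by linarith
        then show ?thesis
          using that by (simp add: h_def triple_term_def pair_mon_def mult.assoc fps_nth_X_power_mult_0)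
      qed
      then have "{k \<in> Sigma UNIV ?B. h k $ n \<noteq> 0} \<subseteq> ({..n} \<times> {..n}) \<times> {..n}"
        by (force simp: not_less[symmetric])
      then show "finite {k \<in> Sigma UNIV ?B. h k $ n \<noteq> 0}"
        by (rule finite_subset) simp
    qed
  qed
  also have "(h has_sum lower_sum t 0) (Sigma UNIV ?B) \<longleftrightarrow> ?thesis"
    by (rule has_sum_reindex_bij_witness[of _ "\<lambda>(a, c, d). ((a + d, a + c), a)"
          "\<lambda>((i, j), a). (a, j - a, i - a)"]) (auto simp: h_def)
  finally show ?thesis .
qed

lemma has_sum_sum_term: "(sum_term t has_sum lower_sum t 0) UNIV"
proof -
  define h where "h = (\<lambda>((a, c, d), b). sum_term t (a, b, c, d))"
  have reindex: "(sum_term t has_sum S) UNIV \<longleftrightarrow> (h has_sum S) (Sigma UNIV (\<lambda>_. UNIV))" for S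
    by (rule has_sum_reindex_bij_witness[of _ "\<lambda>((a, c, d), b). (a, b, c, d)"
          "\<lambda>(a, b, c, d). ((a, c, d), b)"]) (auto simp: h_def)
  have "(h has_sum lower_sum t 0) (Sigma UNIV (\<lambda>_. UNIV))"
  proof (rule has_sum_SigmaI[OF _ has_sum_triple])
    show "((\<lambda>b. h (k, b)) has_sum (case k of (a, c, d) \<Rightarrow>
        triple_term (a, c, d) * distinct_tail t ((a + d) + (a + c)))) UNIV" for k
    proof -
      obtain a c d where k: "k = (a, c, d)" by (cases k) auto
      show ?thesis
        unfolding k prod.case h_def sum_term_eq distinct_tail_def
        by (intro has_sum_cmult_right has_sum_euler) (use t in auto)
    qed
    show "h summable_on Sigma UNIV (\<lambda>_. UNIV)"
      using summable_sum_term unfolding summable_on_def reindex .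
  qed
  then show ?thesis
    by (simp only: reindex)
qed

subsection \<open>The product\<close>

text \<open>At \<open>N = 0\<close> the factors \<open>distinct_upto\<close> and
  \<open>distinct_tail\<close> at \<open>i + j\<close> multiply to the constant
  \<open>distinct_tail t 0\<close>, so the double series separates into one Euler series in
  \<open>i\<close> and one in \<open>j\<close>.\<close>

lemma lower_sum_0:
  "lower_sum t 0 = distinct_tail t 0 *
     (euler_sum (fps_X ^ (t + 1)) (fps_X ^ (2 * t)) * euler_sum (fps_X ^ (t - 1)) (fps_X ^ (2 * t)))"
proof -
  let ?f = "euler_term (fps_X ^ (t + 1)) (fps_X ^ (2 * t) :: rat fps)"
  let ?g = "euler_term (fps_X ^ (t - 1)) (fps_X ^ (2 * t) :: rat fps)"
  have eq: "lower_term t 0 (i, j) = distinct_tail t 0 * (?f i * ?g j)" for i j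
  proof -
    have "t * i\<^sup>2 + i = (t + 1) * i + 2 * t * (i choose 2)"
      unfolding two_choose_two[symmetric, of i] by (simp add: algebra_simps)
    moreover have "t * j\<^sup>2 - j = (t - 1) * j + 2 * t * (j choose 2)"
    proof -
      obtain t' where "t = Suc t'" using t by (cases t) auto
      then show ?thesis
        unfolding two_choose_two[symmetric, of j] by (simp add: algebra_simps)
    qed
    ultimately have "pair_mon t 0 i j = (fps_X ^ (t + 1)) ^ i * (fps_X ^ (2 * t)) ^ (i choose 2) *
        ((fps_X ^ (t - 1)) ^ j * (fps_X ^ (2 * t)) ^ (j choose 2))"
      unfolding pair_mon_def by (simp only: power_mult[symmetric] power_add[symmetric]) simp
    then show ?thesis
      unfolding lower_term_def prod.case distinct_tail_0[OF t, of "i + j"] euler_term_def inv_even_def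
      by (simp add: mult_ac)
  qed
  have "(\<lambda>(i, j). distinct_tail t 0 * (?f i * ?g j)) = lower_term t 0"
    by (rule ext, clarify) (simp only: prod.case eq)
  then have "((\<lambda>(i, j). distinct_tail t 0 * (?f i * ?g j)) has_sum lower_sum t 0) (UNIV \<times> UNIV)"
    using has_sum_lower[OF t, of 0] by (simp only: UNIV_Times_UNIV)
  then have "((\<lambda>i. distinct_tail t 0 * (?f i * euler_sum (fps_X ^ (t - 1)) (fps_X ^ (2 * t))))
      has_sum lower_sum t 0) UNIV"
    by (rule has_sum_SigmaD, unfold prod.case) (intro has_sum_cmult_right has_sum_euler; use t in auto)
  moreover have "((\<lambda>i. distinct_tail t 0 * (?f i * euler_sum (fps_X ^ (t - 1)) (fps_X ^ (2 * t))))
      has_sum distinct_tail t 0 *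
     (euler_sum (fps_X ^ (t + 1)) (fps_X ^ (2 * t)) * euler_sum (fps_X ^ (t - 1)) (fps_X ^ (2 * t)))) UNIV"
    by (intro has_sum_cmult_right has_sum_cmult_left has_sum_euler; use t in auto)
  ultimately show ?thesis
    by (rule has_sum_unique)
qed

lemma prod_product_factor:
  "(\<Prod>n\<le>2 * t * M. product_factor t n) = distinct_upto t (2 * M) *
     (qpochhammer (- (fps_X ^ (t + 1))) (fps_X ^ (2 * t)) M *
      qpochhammer (- (fps_X ^ (t - 1))) (fps_X ^ (2 * t)) M)"
proof (induction M)
  case 0
  then show ?case by (simp add: product_factor_def distinct_upto_def)
next
  case (Suc M)
  \<comment> \<open>The indices with a nontrivial factor in the next block of length
    \<open>2 * t\<close>; its right end stands for the residue 0.\<close>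
  define S where "S = {2 * t * M + (t - 1), 2 * t * M + t, 2 * t * M + (t + 1), 2 * t * M + 2 * t}"
  have mem: "product_factor t n = (if n \<in> S then 1 + fps_X ^ n else 1)"
    if n: "n \<in> {2 * t * M<..2 * t * M + 2 * t}" for n
  proof -
    obtain r where r: "n = 2 * t * M + r" "0 < r" "r \<le> 2 * t"
      using n by (auto simp: less_iff_Suc_add)
    have "n mod (2 * t) = r mod (2 * t)"
      unfolding r by (rule mod_mult_self4)
    also have "\<dots> = (if r = 2 * t then 0 else r)"
      using r by simp
    finally have "n mod (2 * t) = (if r = 2 * t then 0 else r)" .
    then show ?thesis
      using t r(2,3) unfolding product_factor_def cong_def S_def r(1) by auto
  qed
  have "{..2 * t * Suc M} = {..2 * t * M} \<union> {2 * t * M<..2 * t * M + 2 * t}"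
    by auto
  then have "(\<Prod>n\<le>2 * t * Suc M. product_factor t n) =
      (\<Prod>n\<le>2 * t * M. product_factor t n) * (\<Prod>n\<in>{2 * t * M<..2 * t * M + 2 * t}. product_factor t n)"
    by (simp only:) (subst prod.union_disjoint, auto)
  also have "(\<Prod>n\<in>{2 * t * M<..2 * t * M + 2 * t}. product_factor t n) = (\<Prod>n\<in>S. 1 + fps_X ^ n)"
  proof (rule prod.mono_neutral_cong_right)
    show S: "S \<subseteq> {2 * t * M<..2 * t * M + 2 * t}"
      using t by (auto simp: S_def)
    show "product_factor t n = 1 + fps_X ^ n" if "n \<in> S" for n
      using mem[of n] S that by auto
  qed (use mem in auto)
  also have "\<dots> = (1 + fps_X ^ (2 * t * M + (t - 1))) * (1 + fps_X ^ (2 * t * M + t)) *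
      (1 + fps_X ^ (2 * t * M + (t + 1))) * (1 + fps_X ^ (2 * t * M + 2 * t))"
  proof -
    \<comment> \<open>The four indices are distinct; \<open>t + 1\<close> and \<open>2 * t\<close>
      differ because \<open>t > 1\<close>.\<close>
    have "s + (t - 1) \<notin> {s + t, s + (t + 1), s + 2 * t}" "s + t \<notin> {s + (t + 1), s + 2 * t}"
      "s + (t + 1) \<notin> {s + 2 * t}" for s
      using t by auto
    then show ?thesis
      by (simp only: S_def prod.insert empty_iff finite.emptyI finite_insert not_False_eq_True prod.empty
          mult_1_right mult.assoc)
  qed
  also have "(\<Prod>n\<le>2 * t * M. product_factor t n) * \<dots> =
      (distinct_upto t (2 * M) * (1 + fps_X ^ (2 * t * M + t)) * (1 + fps_X ^ (2 * t * M + 2 * t))) *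
      (qpochhammer (- (fps_X ^ (t + 1))) (fps_X ^ (2 * t)) M * (1 + fps_X ^ (2 * t * M + (t + 1))) *
      (qpochhammer (- (fps_X ^ (t - 1))) (fps_X ^ (2 * t)) M * (1 + fps_X ^ (2 * t * M + (t - 1)))))"
    unfolding Suc.IH by (simp only: mult_ac)
  also have "\<dots> = distinct_upto t (2 * Suc M) *
     (qpochhammer (- (fps_X ^ (t + 1))) (fps_X ^ (2 * t)) (Suc M) *
      qpochhammer (- (fps_X ^ (t - 1))) (fps_X ^ (2 * t)) (Suc M))"
  proof -
    have "distinct_upto t (2 * Suc M) =
        distinct_upto t (2 * M) * (1 + fps_X ^ (2 * t * M + t)) * (1 + fps_X ^ (2 * t * M + 2 * t))"
      by (simp add: distinct_upto_Suc[OF t] algebra_simps)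
    moreover have "qpochhammer (- (fps_X ^ k)) (fps_X ^ (2 * t)) (Suc M) =
        qpochhammer (- (fps_X ^ k)) (fps_X ^ (2 * t)) M * (1 + fps_X ^ (2 * t * M + k) :: rat fps)" for k
    proof -
      have "fps_X ^ (2 * t * M + k) = (fps_X ^ k * (fps_X ^ (2 * t)) ^ M :: rat fps)"
        unfolding power_add power_mult by (rule mult.commute)
      then show ?thesis
        by (simp only: qpochhammer_Suc) simp
    qed
    ultimately show ?thesis
      by (simp only:)
  qed
  finally show ?case .
qed

end

section \<open>Partitions into distinct parts as finite sets of parts\<close>

lemma prod_one_plus_X_power_nth:
  assumes "finite S"
  shows "(\<Prod>i\<in>S. 1 + fps_X ^ i :: 'a::comm_ring_1 fps) $ n = of_nat (card {T. T \<subseteq> S \<and> \<Sum>T = n})"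
proof -
  have "(\<Prod>i\<in>S. 1 + fps_X ^ i :: 'a fps) = (\<Prod>i\<in>S. fps_X ^ i + 1)"
    by (simp add: add.commute)
  also have "\<dots> = (\<Sum>T\<in>Pow S. fps_X ^ \<Sum>T)"
    using assms by (subst prod_add) (auto simp: power_sum)
  finally have "(\<Prod>i\<in>S. 1 + fps_X ^ i :: 'a fps) $ n = (\<Sum>T\<in>Pow S. if n = \<Sum>T then 1 else 0)"
    by (simp add: fps_sum_nth fps_X_power_nth)
  also have "\<dots> = of_nat (card {T \<in> Pow S. n = \<Sum>T})"
    using assms by (subst sum.inter_filter[symmetric]) auto
  also have "{T \<in> Pow S. n = \<Sum>T} = {T. T \<subseteq> S \<and> \<Sum>T = n}"
    by auto
  finally show ?thesis .
qed

lemma card_distinct_partitions: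
  fixes n :: nat
  assumes "\<And>x. x \<in> S \<Longrightarrow> x > 0"
  shows "card {p. is_partition n p \<and> distinct p \<and> set p \<subseteq> S} = card {T. finite T \<and> T \<subseteq> S \<and> \<Sum>T = n}"
proof (rule bij_betw_same_card)
  show "bij_betw set {p. is_partition n p \<and> distinct p \<and> set p \<subseteq> S} {T. finite T \<and> T \<subseteq> S \<and> \<Sum>T = n}"
  proof (rule bij_betw_byWitness[where f' = "\<lambda>T. rev (sorted_list_of_set T)"])
    show "\<forall>p\<in>{p. is_partition n p \<and> distinct p \<and> set p \<subseteq> S}. rev (sorted_list_of_set (set p)) = p"
    proof safe
      fix p assume "is_partition n p" "distinct p"
      then have "sorted (rev p)" "distinct (rev p)"
        by (auto simp: is_partition_def sorted_wrt_rev)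
      then have "sorted_list_of_set (set p) = rev p"
        by (metis set_rev sorted_list_of_set.idem_if_sorted_distinct)
      then show "rev (sorted_list_of_set (set p)) = p" by simp
    qed
    show "set ` {p. is_partition n p \<and> distinct p \<and> set p \<subseteq> S} \<subseteq> {T. finite T \<and> T \<subseteq> S \<and> \<Sum>T = n}"
      using sum_list_distinct_conv_sum_set[of _ "\<lambda>x. x :: nat"] by (auto simp: is_partition_def)
    show "(\<lambda>T. rev (sorted_list_of_set T)) ` {T. finite T \<and> T \<subseteq> S \<and> \<Sum>T = n} \<subseteq>
        {p. is_partition n p \<and> distinct p \<and> set p \<subseteq> S}"
    proof -
      have "sum_list (sorted_list_of_set T) = \<Sum>T" if "finite T" for T :: "nat set"
        using sum_list_distinct_conv_sum_set[of "sorted_list_of_set T" "\<lambda>x. x"] that by simp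
      then show ?thesis
        using assms by (auto simp: is_partition_def sorted_wrt_rev)
    qed
  qed auto
qed

lemma product_factor_tendsto: "(\<lambda>N. \<Prod>n\<le>N. product_factor t n) \<longlonglongrightarrow> partition_gf (product_class t)"
proof (rule tendsto_fpsI)
  fix n
  define S where "S = {x. x > 0 \<and> ([x = 0] (mod 2 * t) \<or> [x = t - 1] (mod 2 * t) \<or>
                [x = t] (mod 2 * t) \<or> [x = t + 1] (mod 2 * t))}"
  \<comment> \<open>No part exceeds the sum of all parts, so coefficient \<open>n\<close> is final
    once \<open>N >= n\<close>.\<close>
  have "(\<Prod>i\<le>N. product_factor t i) $ n = partition_gf (product_class t) $ n" if "N \<ge> n" for N
  proof -
    have "(\<Prod>i\<le>N. product_factor t i) = (\<Prod>i\<in>S \<inter> {..N}. 1 + fps_X ^ i)"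
      by (rule prod.mono_neutral_cong_right) (auto simp: product_factor_def S_def)
    then have "(\<Prod>i\<le>N. product_factor t i) $ n = of_nat (card {T. T \<subseteq> S \<inter> {..N} \<and> \<Sum>T = n})"
      by (simp add: prod_one_plus_X_power_nth)
    also have "{T. T \<subseteq> S \<inter> {..N} \<and> \<Sum>T = n} = {T. finite T \<and> T \<subseteq> S \<and> \<Sum>T = n}"
    proof (intro equalityI subsetI CollectI)
      fix T assume T: "T \<in> {T. finite T \<and> T \<subseteq> S \<and> \<Sum>T = n}"
      have "x \<le> \<Sum>T" if "x \<in> T" for x
        using T that by (intro member_le_sum) auto
      then show "T \<subseteq> S \<inter> {..N} \<and> \<Sum>T = n"
        using T \<open>N \<ge> n\<close> by fastforce
    qed (auto intro: finite_subset)
    also have "card \<dots> = card {p. is_partition n p \<and> distinct p \<and> set p \<subseteq> S}"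
      by (rule card_distinct_partitions[symmetric]) (auto simp: S_def)
    also have "{p. is_partition n p \<and> distinct p \<and> set p \<subseteq> S} = {p. is_partition n p \<and> product_class t p}"
      by (auto simp: product_class_def S_def is_partition_def)
    finally show ?thesis
      by (simp add: partition_gf_def)
  qed
  then show "\<forall>\<^sub>F N in sequentially.
      (\<Prod>i\<le>N. product_factor t i) $ n = partition_gf (product_class t) $ n"
    by (auto simp: eventually_sequentially)
qed

text \<open>Two limits of the same partial products, taken along the multiples of
  \<open>2 * t\<close>, where \<open>prod_product_factor\<close> has a closed form.\<close>

lemma product_gf_eq_lower_sum:
  assumes t: "t > 1"
  shows "partition_gf (product_class t) = lower_sum t 0"
proof (rule LIMSEQ_unique)
  have "filterlim (\<lambda>M. 2 * t * M) at_top sequentially"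
    using t by (intro filterlim_subseq strict_monoI) auto
  then show "(\<lambda>M. \<Prod>n\<le>2 * t * M. product_factor t n) \<longlonglongrightarrow> partition_gf (product_class t)"
    by (rule filterlim_compose[OF product_factor_tendsto])
  have "filterlim (\<lambda>M. 2 * M) at_top (sequentially :: nat filter)"
    by (intro filterlim_subseq strict_monoI) auto
  moreover have "distinct_upto t \<longlonglongrightarrow> distinct_tail t 0"
    unfolding distinct_upto_def[abs_def] distinct_tail_def
    using t tendsto_qpochhammer[of "fps_X ^ t" "fps_X ^ t :: rat fps"] by simp
  ultimately have "(\<lambda>M. distinct_upto t (2 * M)) \<longlonglongrightarrow> distinct_tail t 0"
    by (rule filterlim_compose[rotated])
  then show "(\<lambda>M. \<Prod>n\<le>2 * t * M. product_factor t n) \<longlonglongrightarrow> lower_sum t 0"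
    unfolding prod_product_factor[OF t] lower_sum_0[OF t]
    by (intro tendsto_mult tendsto_qpochhammer) (use t in auto)
qed

text \<open>Convergence of an infinite product demands a nonzero limit; the empty partition makes
  its constant coefficient 1.\<close>

lemma raw_has_prod_product_factor:
  "raw_has_prod (product_factor t) 0 (partition_gf (product_class t))"
proof -
  have "p = []" if "is_partition 0 p" for p
    using that by (cases p) (auto simp: is_partition_def)
  then have "{p. is_partition 0 p \<and> product_class t p} = {[]}"
    by (auto simp: is_partition_def product_class_def)
  then have "partition_gf (product_class t) $ 0 = 1"
    by (simp add: partition_gf_def)
  then have "partition_gf (product_class t) \<noteq> 0"
    by auto
  then show ?thesis
    using product_factor_tendsto[of t] by (simp add: raw_has_prod_def)
qed

subsection \<open>Partitions with difference conditions\<close>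

definition list_gf :: "nat list set \<Rightarrow> rat fps" where
  "list_gf A = Abs_fps (\<lambda>n. of_nat (card {p \<in> A. sum_list p = n}))"

lemma list_gf_union:
  assumes "A \<inter> B = {}" "\<And>n. finite {p \<in> A. sum_list p = n}" "\<And>n. finite {p \<in> B. sum_list p = n}"
  shows "list_gf (A \<union> B) = list_gf A + list_gf B"
proof (rule fps_ext)
  fix n
  have "{p \<in> A \<union> B. sum_list p = n} = {p \<in> A. sum_list p = n} \<union> {p \<in> B. sum_list p = n}"
    by auto
  moreover have "card \<dots> = card {p \<in> A. sum_list p = n} + card {p \<in> B. sum_list p = n}"
    using assms by (intro card_Un_disjoint) auto
  ultimately show "list_gf (A \<union> B) $ n = (list_gf A + list_gf B) $ n"
    by (simp add: list_gf_def)
qed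

lemma list_gf_snoc: "list_gf ((\<lambda>p. p @ [m]) ` A) = fps_X ^ m * list_gf A"
proof (rule fps_ext)
  fix n
  have "{p \<in> (\<lambda>p. p @ [m]) ` A. sum_list p = n} =
      (if n < m then {} else (\<lambda>p. p @ [m]) ` {p \<in> A. sum_list p = n - m})"
    by auto
  moreover have "card ((\<lambda>p. p @ [m]) ` {p \<in> A. sum_list p = n - m}) = card {p \<in> A. sum_list p = n - m}"
    by (rule card_image) (simp add: inj_on_def)
  ultimately show "list_gf ((\<lambda>p. p @ [m]) ` A) $ n = (fps_X ^ m * list_gf A) $ n"
    by (simp add: list_gf_def fps_X_power_mult_nth)
qed

definition admissible :: "nat \<Rightarrow> nat \<Rightarrow> bool" where
  "admissible t x \<longleftrightarrow> x > 1 \<and>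
     ([int x = 0] (mod int t) \<or> [int x = 1] (mod int t) \<or> [int x = - 1] (mod int t))"

definition gap_ok :: "nat \<Rightarrow> nat \<Rightarrow> nat \<Rightarrow> bool" where
  "gap_ok t x y \<longleftrightarrow> int x - int y \<ge> int t + 1 \<or> ([x = 0] (mod t) \<and> [y = 0] (mod t)) \<or>
     [x + y = 0] (mod 2 * t)"

lemma sum_class_iff:
  "sum_class t p \<longleftrightarrow> distinct p \<and> (\<forall>x\<in>set p. admissible t x) \<and> successively (gap_ok t) p"
  unfolding sum_class_def admissible_def gap_ok_def successively_conv_nth ..

definition sum_parts_from :: "nat \<Rightarrow> nat \<Rightarrow> nat list set" where
  "sum_parts_from t L = {p. sorted_wrt (\<ge>) p \<and> (\<forall>x\<in>set p. L \<le> x) \<and> sum_class t p}"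

definition sum_gf_from :: "nat \<Rightarrow> nat \<Rightarrow> rat fps" where
  "sum_gf_from t L = list_gf (sum_parts_from t L)"

lemma sum_parts_from_imp_partition: "p \<in> sum_parts_from t L \<Longrightarrow> is_partition (sum_list p) p"
  by (auto simp: sum_parts_from_def is_partition_def sum_class_iff admissible_def)

lemma finite_sum_parts_from:
  assumes "A \<subseteq> sum_parts_from t L"
  shows "finite {p \<in> A. sum_list p = n}"
  by (rule finite_subset[OF _ finite_partitions[of n]]) (use assms sum_parts_from_imp_partition in auto)

text \<open>The lists decrease, so the smallest part stands last. Distinctness turns the bound
  \<open>y\<close> for the other parts into \<open>Suc y\<close>, and only the neighbour
  \<open>last p\<close> meets a new gap condition.\<close>

lemma snoc_in_sum_parts_from:
  "p @ [y] \<in> sum_parts_from t L \<longleftrightarrow> p \<in> sum_parts_from t (Suc y) \<and> L \<le> y \<and> admissible t y \<and>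
     (p = [] \<or> gap_ok t (last p) y)"
proof -
  have "(\<forall>x\<in>set p. y \<le> x) \<and> y \<notin> set p \<and> (\<forall>x\<in>set p. L \<le> x) \<and> L \<le> y \<longleftrightarrow>
      (\<forall>x\<in>set p. Suc y \<le> x) \<and> L \<le> y"
    by (fastforce simp: Suc_le_eq order.strict_iff_order)
  moreover have "p @ [y] \<in> sum_parts_from t L \<longleftrightarrow>
      ((\<forall>x\<in>set p. y \<le> x) \<and> y \<notin> set p \<and> (\<forall>x\<in>set p. L \<le> x) \<and> L \<le> y) \<and>
      sorted_wrt (\<ge>) p \<and> sum_class t p \<and> admissible t y \<and> (p = [] \<or> gap_ok t (last p) y)"
    by (auto simp: sum_parts_from_def sum_class_iff successively_append_iff sorted_wrt_append)
  ultimately show ?thesis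
    by (auto simp: sum_parts_from_def)
qed

lemma sum_parts_from_mono: "L \<le> M \<Longrightarrow> sum_parts_from t M \<subseteq> sum_parts_from t L"
  by (auto simp: sum_parts_from_def)

lemma sum_parts_from_last:
  assumes "p \<in> sum_parts_from t L"
  shows "p \<in> sum_parts_from t M \<longleftrightarrow> p = [] \<or> M \<le> last p"
  using assms by (cases p rule: rev_cases) (auto simp: sum_parts_from_def sorted_wrt_append)

lemma sum_parts_from_cong:
  assumes "L \<le> M" "\<And>x. admissible t x \<Longrightarrow> L \<le> x \<Longrightarrow> M \<le> x"
  shows "sum_parts_from t L = sum_parts_from t M"
  using assms by (fastforce simp: sum_parts_from_def sum_class_iff)

lemma sum_parts_from_split:
  assumes "admissible t L"
  shows "sum_parts_from t L = sum_parts_from t (Suc L) \<union>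
    (\<lambda>p. p @ [L]) ` {p \<in> sum_parts_from t (Suc L). p = [] \<or> gap_ok t (last p) L}"
    (is "_ = _ \<union> ?B")
proof (intro equalityI subsetI)
  fix p assume p: "p \<in> sum_parts_from t L"
  show "p \<in> sum_parts_from t (Suc L) \<union> ?B"
  proof (cases p rule: rev_cases)
    case Nil
    then show ?thesis using p by (simp add: sum_parts_from_def)
  next
    case (snoc q y)
    show ?thesis
    proof (cases "y = L")
      case True
      then show ?thesis using p snoc snoc_in_sum_parts_from by auto
    next
      case False
      then show ?thesis using p snoc sum_parts_from_last[OF p, of "Suc L"]
        by (auto simp: snoc_in_sum_parts_from)
    qed
  qed
next
  fix p assume "p \<in> sum_parts_from t (Suc L) \<union> ?B"
  then show "p \<in> sum_parts_from t L"
    using assms sum_parts_from_mono[of L "Suc L" t] snoc_in_sum_parts_from[of "[]" L t L]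
    by (auto simp: snoc_in_sum_parts_from)
qed

lemma sum_gf_from_split:
  assumes "admissible t L"
  shows "sum_gf_from t L = sum_gf_from t (Suc L) +
    fps_X ^ L * list_gf {p \<in> sum_parts_from t (Suc L). p = [] \<or> gap_ok t (last p) L}"
proof -
  let ?B = "(\<lambda>p. p @ [L]) ` {p \<in> sum_parts_from t (Suc L). p = [] \<or> gap_ok t (last p) L}"
  have B: "?B \<subseteq> sum_parts_from t L"
    using sum_parts_from_split[OF assms] by blast
  have "list_gf (sum_parts_from t (Suc L) \<union> ?B) = list_gf (sum_parts_from t (Suc L)) + list_gf ?B"
  proof (rule list_gf_union)
    show "sum_parts_from t (Suc L) \<inter> ?B = {}"
      by (auto simp: sum_parts_from_def)
    show "finite {p \<in> sum_parts_from t (Suc L). sum_list p = n}" for n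
      by (rule finite_sum_parts_from[OF order_refl])
    show "finite {p \<in> ?B. sum_list p = n}" for n
      by (rule finite_sum_parts_from[OF B])
  qed
  then show ?thesis
    unfolding sum_gf_from_def list_gf_snoc sum_parts_from_split[OF assms, symmetric] .
qed

text \<open>The counterpart of \<open>pair_sums_nth\<close>: a nonempty partition with all parts at
  least \<open>L\<close> has sum at least \<open>L\<close>.\<close>

lemma sum_gf_from_nth:
  assumes "n < L"
  shows "sum_gf_from t L $ n = (if n = 0 then 1 else 0)"
proof -
  have "p = []" if "p \<in> sum_parts_from t L" "sum_list p = n" for p
    using that assms by (cases p) (auto simp: sum_parts_from_def)
  moreover have "[] \<in> sum_parts_from t L"
    by (simp add: sum_parts_from_def sum_class_iff)
  ultimately have "{p \<in> sum_parts_from t L. sum_list p = n} = (if n = 0 then {[]} else {})"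
    by (cases "n = 0") fastforce+
  then show ?thesis
    by (simp add: sum_gf_from_def list_gf_def)
qed

section \<open>The gap condition in terms of residues modulo \<open>t\<close>\<close>

context
  fixes t :: nat
  assumes t: "t > 3"
begin

lemma admissible_cases:
  assumes "admissible t x"
  obtains m e :: int where "int x = int t * m + e" "e \<in> {-1, 0, 1}"
proof -
  from assms obtain e :: int where e: "[int x = e] (mod int t)" "e \<in> {-1, 0, 1}"
    unfolding admissible_def by blast
  from e(1) obtain k where "e = int x + int t * k"
    unfolding cong_iff_lin by blast
  then have "int x = int t * (- k) + e" by simp
  with e(2) show ?thesis
    by (rule that[rotated])
qed

lemma int_minus_1: "m > 0 \<Longrightarrow> int (m - 1) = int m - 1"
  by simp

lemma admissible_multiple:
  assumes "k > 0"
  shows "admissible t (t * k - 1)" "admissible t (t * k)" "admissible t (t * k + 1)"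
proof -
  have "t \<le> t * k"
    using assms by simp
  with t have "t * k > 3" by linarith
  then have *: "t * k > 3" "int (t * k - 1) = int t * int k - 1"
    using int_minus_1[of "t * k"] by (simp_all only: of_nat_mult)
  have "[int t * int k - 1 = -1] (mod int t)" "[int t * int k = 0] (mod int t)"
    "[int t * int k + 1 = 1] (mod int t)"
    by (auto simp: cong_iff_dvd_diff)
  moreover have "t * k - 1 > 1" "t * k > 1" "t * k + 1 > 1"
    using *(1) by linarith+
  ultimately show "admissible t (t * k - 1)" "admissible t (t * k)" "admissible t (t * k + 1)"
    unfolding admissible_def *(2) of_nat_add of_nat_mult of_nat_1 by blast+
qed

text \<open>Residues -1, 0, 1 and sums of two of them lie between -2 and 2; as \<open>t > 3\<close>,
  only 0 among these is a multiple of \<open>t\<close>.\<close>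

lemma small_residue_dvd:
  fixes s n :: int
  assumes "\<bar>s\<bar> \<le> 2"
  shows "int t dvd int t * n + s \<longleftrightarrow> s = 0" "2 * int t dvd int t * n + s \<longleftrightarrow> s = 0 \<and> even n"
proof -
  have "int t dvd int t * n + s \<longleftrightarrow> int t dvd s"
    by (rule dvd_add_right_iff) simp
  moreover have "int t dvd s \<longleftrightarrow> s = 0"
    using t assms dvd_imp_le_int[of s "int t"] by fastforce
  ultimately show *: "int t dvd int t * n + s \<longleftrightarrow> s = 0"
    by simp
  have "2 * int t dvd int t * n \<longleftrightarrow> even n"
    using t by (subst mult.commute) simp
  moreover have "int t dvd int t * n + s" if "2 * int t dvd int t * n + s"
    using that by (rule dvd_mult_right)
  ultimately show "2 * int t dvd int t * n + s \<longleftrightarrow> s = 0 \<and> even n"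
    using * by (cases "s = 0") auto
qed

text \<open>The sum condition fixes the parity of \<open>m + k\<close>, which is that of
  \<open>m - k\<close>; in this form everything depends on \<open>e\<close>, \<open>f\<close> and
  \<open>m - k\<close> alone.\<close>

lemma gap_ok_iff:
  fixes m k e f :: int
  assumes x: "int x = int t * m + e" "\<bar>e\<bar> \<le> 1" and y: "int y = int t * k + f" "\<bar>f\<bar> \<le> 1"
  shows "gap_ok t x y \<longleftrightarrow>
    int t * (m - k) + e - f \<ge> int t + 1 \<or> (e = 0 \<and> f = 0) \<or> (e + f = 0 \<and> even (m - k))"
proof -
  have "[x = 0] (mod t) \<longleftrightarrow> int t dvd int t * m + e" "[y = 0] (mod t) \<longleftrightarrow> int t dvd int t * k + f"
    unfolding x(1)[symmetric] y(1)[symmetric] by (auto simp: cong_0_iff)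
  moreover have "[x + y = 0] (mod 2 * t) \<longleftrightarrow> 2 * int t dvd int t * (m + k) + (e + f)"
  proof -
    have "int t * (m + k) + (e + f) = int (x + y)"
      using x y by (simp add: distrib_left)
    then show ?thesis
      by (metis cong_0_iff int_dvd_int_iff of_nat_mult of_nat_numeral)
  qed
  moreover have "int x - int y = int t * (m - k) + e - f"
    using x y by (simp add: right_diff_distrib)
  moreover have "int t dvd int t * m + e \<longleftrightarrow> e = 0" "int t dvd int t * k + f \<longleftrightarrow> f = 0"
    "2 * int t dvd int t * (m + k) + (e + f) \<longleftrightarrow> e + f = 0 \<and> even (m - k)"
    using x(2) y(2) by (subst small_residue_dvd, linarith, simp)+
  ultimately show ?thesis
    unfolding gap_ok_def by simp
qed

text \<open>Makes the later arguments linear: with \<open>t * d\<close> abbreviated to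
  \<open>z\<close>, these four cases are all that is needed about the product.\<close>

lemma multiple_cases:
  fixes d :: int
  shows "d < 0 \<and> int t * d \<le> - int t \<or> d = 0 \<and> int t * d = 0 \<or> d = 1 \<and> int t * d = int t \<or>
    d \<ge> 2 \<and> int t * d \<ge> 2 * int t"
proof -
  have neg: "int t * d \<le> - int t" if "d < 0"
    using mult_left_mono[of d "-1" "int t"] that by simp
  have ge2: "2 * int t \<le> int t * d" if "d \<ge> 2"
    using mult_left_mono[of 2 d "int t"] that by simp
  consider "d < 0" | "d = 0" | "d = 1" | "d \<ge> 2"
    by linarith
  then show ?thesis
  proof cases
    case 1
    then show ?thesis using neg by blast
  next
    case 4
    then show ?thesis using ge2 by blast
  qed simp_all
qed

text \<open>Above \<open>t * k\<close> and \<open>t * k + 1\<close> the permitted parts are given by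
  a lower bound; above \<open>t * k - 1\<close> there is the one exception \<open>t * k + 1\<close>,
  with sum \<open>2 * t * k\<close>. Parity matters: \<open>t * Suc k - 1\<close> is too close to
  \<open>t * k + 1\<close>, and their sum is an odd multiple of \<open>t\<close>.\<close>

lemma gap_ok_multiple:
  assumes x: "admissible t x" and "k > 0"
  shows "x > t * k - 1 \<Longrightarrow> gap_ok t x (t * k - 1) \<longleftrightarrow> x = t * k + 1 \<or> t * Suc k \<le> x"
    and "x > t * k \<Longrightarrow> gap_ok t x (t * k) \<longleftrightarrow> t * Suc k \<le> x"
    and "x > t * k + 1 \<Longrightarrow> gap_ok t x (t * k + 1) \<longleftrightarrow> t * Suc (Suc k) - 1 \<le> x"
proof -
  obtain m e where x: "int x = int t * m + e" "e \<in> {-1, 0, 1}"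
    using admissible_cases[OF x] .
  define d where "d = m - int k"
  define z where "z = int t * d"
  note z = multiple_cases[of d, folded z_def]
  have m: "m = d + int k" by (simp add: d_def)
  have tk: "int (t * k - 1) = int t * int k - 1" and
    tk2: "int (t * Suc (Suc k) - 1) = int t * int k + 2 * int t - 1"
    using t \<open>k > 0\<close> int_minus_1[of "t * k"] int_minus_1[of "t * Suc (Suc k)"] by (auto simp: distrib_left)
  have x': "int x = int t * int k + z + e"
    using x by (simp add: m z_def algebra_simps)
  have le: "y \<le> x \<longleftrightarrow> int y \<le> int t * int k + z + e" "x > y \<longleftrightarrow> int t * int k + z + e > int y"
    "x = y \<longleftrightarrow> int t * int k + z + e = int y" for y
    using x' by auto
  show "gap_ok t x (t * k - 1) \<longleftrightarrow> x = t * k + 1 \<or> t * Suc k \<le> x" if "x > t * k - 1"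
  proof -
    have "gap_ok t x (t * k - 1) \<longleftrightarrow> z + e + 1 \<ge> int t + 1 \<or> (e = 1 \<and> even d)"
      using gap_ok_iff[OF x(1) _ tk[unfolded diff_conv_add_uminus]] x(2) by (auto simp: d_def z_def)
    with that t x(2) z show ?thesis
      unfolding le tk by (auto simp: distrib_left)
  qed
  show "gap_ok t x (t * k) \<longleftrightarrow> t * Suc k \<le> x" if "x > t * k"
  proof -
    have "gap_ok t x (t * k) \<longleftrightarrow> z + e \<ge> int t + 1 \<or> e = 0"
      using gap_ok_iff[OF x(1), of "t * k" "int k" 0] x(2) by (auto simp: d_def z_def)
    with that t x(2) z show ?thesis
      unfolding le by (auto simp: distrib_left)
  qed
  show "gap_ok t x (t * k + 1) \<longleftrightarrow> t * Suc (Suc k) - 1 \<le> x" if "x > t * k + 1"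
  proof -
    have "gap_ok t x (t * k + 1) \<longleftrightarrow> z + e - 1 \<ge> int t + 1 \<or> (e = -1 \<and> even d)"
      using gap_ok_iff[OF x(1), of "t * k + 1" "int k" 1] x(2) by (auto simp: d_def z_def)
    with that t x(2) z show ?thesis
      unfolding le tk2 by (auto simp: distrib_left)
  qed
qed

lemma admissible_gap:
  assumes "admissible t x" "t * k + 2 \<le> x"
  shows "t * Suc k - 1 \<le> x"
proof -
  obtain m e where x: "int x = int t * m + e" "e \<in> {-1, 0, 1}"
    using admissible_cases[OF assms(1)] .
  define d where "d = m - int k"
  define z where "z = int t * d"
  note z = multiple_cases[of d, folded z_def]
  have "int x = int t * int k + z + e"
    using x by (simp add: d_def z_def algebra_simps)
  moreover have "int (t * k + 2) \<le> int x"
    using assms(2) by (simp only: of_nat_le_iff)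
  ultimately have "int (t * k) + int t \<le> int x + 1"
    using x(2) t z by auto
  then have "t * k + t \<le> x + 1"
    by linarith
  then show ?thesis by simp
qed

section \<open>Recurrences for the partitions with difference conditions\<close>

lemma sum_parts_from_gap_plus:
  assumes "k > 0"
  shows "{p \<in> sum_parts_from t (Suc (t * k + 1)). p = [] \<or> gap_ok t (last p) (t * k + 1)}
      = sum_parts_from t (t * Suc (Suc k) - 1)"
    (is "?A = ?B")
proof -
  have "?B \<subseteq> sum_parts_from t (Suc (t * k + 1))"
    using t by (intro sum_parts_from_mono) simp
  moreover have "p = [] \<or> gap_ok t (last p) (t * k + 1) \<longleftrightarrow> p \<in> ?B"
    if p: "p \<in> sum_parts_from t (Suc (t * k + 1))" for p
  proof (cases "p = []")
    case False
    then have "last p \<in> set p" by simp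
    then have "admissible t (last p)" "last p > t * k + 1"
      using p by (auto simp: sum_parts_from_def sum_class_iff)
    from gap_ok_multiple(3)[OF this(1) assms this(2)] show ?thesis
      by (simp only: sum_parts_from_last[OF p])
  qed (use sum_parts_from_last[OF p] in auto)
  ultimately show ?thesis by blast
qed

text \<open>Serves to eliminate the bound \<open>t * k + 1\<close> from
  \<open>sum_gf_from_multiple\<close>, so that only the bounds matched by \<open>lower_sum\<close>
  and \<open>mid_sum\<close> remain.\<close>

lemma sum_gf_from_multiple_plus:
  assumes "k > 0"
  shows "sum_gf_from t (t * k + 1) = sum_gf_from t (t * Suc k - 1) +
    fps_X ^ (t * k + 1) * sum_gf_from t (t * Suc (Suc k) - 1)"
proof -
  \<comment> \<open>No admissible number lies strictly between \<open>t * k + 1\<close> and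
    \<open>t * Suc k - 1\<close>.\<close>
  have "sum_parts_from t (Suc (t * k + 1)) = sum_parts_from t (t * Suc k - 1)"
    using t admissible_gap[of _ k] by (intro sum_parts_from_cong) auto
  then show ?thesis
    using sum_gf_from_split[OF admissible_multiple(3)[OF assms]] sum_parts_from_gap_plus[OF assms]
    by (simp add: sum_gf_from_def)
qed

lemma sum_gf_from_multiple:
  assumes "k > 0"
  shows "sum_gf_from t (t * k) = sum_gf_from t (t * k + 1) + fps_X ^ (t * k) * sum_gf_from t (t * Suc k)"
proof -
  have "{p \<in> sum_parts_from t (Suc (t * k)). p = [] \<or> gap_ok t (last p) (t * k)}
      = sum_parts_from t (t * Suc k)"
    (is "?A = ?B")
  proof -
    have "?B \<subseteq> sum_parts_from t (Suc (t * k))"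
      using t by (intro sum_parts_from_mono) simp
    moreover have "p = [] \<or> gap_ok t (last p) (t * k) \<longleftrightarrow> p \<in> ?B"
      if p: "p \<in> sum_parts_from t (Suc (t * k))" for p
    proof (cases "p = []")
      case False
      then have "last p \<in> set p" by simp
      then have "admissible t (last p)" "last p > t * k"
        using p by (auto simp: sum_parts_from_def sum_class_iff)
      from gap_ok_multiple(2)[OF this(1) assms this(2)] show ?thesis
        by (simp only: sum_parts_from_last[OF p])
    qed (use sum_parts_from_last[OF p] in auto)
    ultimately show ?thesis by blast
  qed
  then show ?thesis
    using sum_gf_from_split[OF admissible_multiple(2)[OF assms]] by (simp add: sum_gf_from_def)
qed

text \<open>In the exceptional case the two smallest parts \<open>t * k - 1\<close> and
  \<open>t * k + 1\<close> are removed together. Their weight is \<open>2 * t * k\<close>, and the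
  rest obeys the bound imposed by \<open>t * k + 1\<close>.\<close>

lemma sum_gf_from_multiple_minus:
  assumes "k > 0"
  shows "sum_gf_from t (t * k - 1) = sum_gf_from t (t * k) +
    fps_X ^ (t * k - 1) * sum_gf_from t (t * Suc k) + fps_X ^ (2 * t * k) * sum_gf_from t (t * Suc (Suc k) - 1)"
proof -
  have "t \<le> t * k"
    using assms by simp
  with t have "t * k > 0" by linarith
  then have tk: "Suc (t * k - 1) = t * k" "t * k > 0" using t by auto
  let ?B = "sum_parts_from t (t * Suc k)"
  let ?C = "(\<lambda>p. p @ [t * k + 1]) ` sum_parts_from t (t * Suc (Suc k) - 1)"
  have C: "?C = {p \<in> sum_parts_from t (t * k). p \<noteq> [] \<and> last p = t * k + 1}"
  proof -
    have "p \<in> ?C" if "p \<in> sum_parts_from t (t * k)" "p \<noteq> []" "last p = t * k + 1" for p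
      using that unfolding sum_parts_from_gap_plus[OF assms, symmetric]
      by (cases p rule: rev_cases) (auto simp: snoc_in_sum_parts_from)
    moreover have "?C \<subseteq> {p \<in> sum_parts_from t (t * k). p \<noteq> [] \<and> last p = t * k + 1}"
      using admissible_multiple(3)[OF assms] snoc_in_sum_parts_from[of "[]" "t * k + 1" t "t * k"]
      unfolding sum_parts_from_gap_plus[OF assms, symmetric] by (auto simp: snoc_in_sum_parts_from)
    ultimately show ?thesis by blast
  qed
  have "{p \<in> sum_parts_from t (t * k). p = [] \<or> gap_ok t (last p) (t * k - 1)} = ?B \<union> ?C"
  proof -
    have "?B \<subseteq> sum_parts_from t (t * k)"
      using t by (intro sum_parts_from_mono) simp
    moreover have "p = [] \<or> gap_ok t (last p) (t * k - 1) \<longleftrightarrow> p \<in> ?B \<or> (p \<noteq> [] \<and> last p = t * k + 1)"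
      if p: "p \<in> sum_parts_from t (t * k)" for p
    proof (cases "p = []")
      case False
      then have "last p \<in> set p" by simp
      then have "admissible t (last p)" "t * k \<le> last p"
        using p by (auto simp: sum_parts_from_def sum_class_iff)
      then have "admissible t (last p)" "last p > t * k - 1"
        using tk by linarith+
      from gap_ok_multiple(1)[OF this(1) assms this(2)] False show ?thesis
        by (auto simp only: sum_parts_from_last[OF p])
    qed (use sum_parts_from_last[OF p] in auto)
    ultimately show ?thesis unfolding C by blast
  qed
  moreover have "list_gf (?B \<union> ?C) = list_gf ?B + list_gf ?C"
  proof (rule list_gf_union)
    show "?B \<inter> ?C = {}"
      using t by (auto simp: sum_parts_from_def)
    show "finite {p \<in> ?C. sum_list p = n}" for n
      unfolding C by (rule finite_sum_parts_from[of _ t "t * k"]) blast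
  qed (rule finite_sum_parts_from[OF order_refl])
  ultimately have "sum_gf_from t (t * k - 1) = sum_gf_from t (t * k) + fps_X ^ (t * k - 1) *
      (sum_gf_from t (t * Suc k) + fps_X ^ (t * k + 1) * sum_gf_from t (t * Suc (Suc k) - 1))"
    using sum_gf_from_split[OF admissible_multiple(1)[OF assms]]
    unfolding tk by (simp only: sum_gf_from_def list_gf_snoc)
  also have "\<dots> = sum_gf_from t (t * k) + fps_X ^ (t * k - 1) * sum_gf_from t (t * Suc k) +
      (fps_X ^ (t * k - 1) * fps_X ^ (t * k + 1)) * sum_gf_from t (t * Suc (Suc k) - 1)"
    by (simp only: distrib_left add.assoc mult.assoc)
  also have "(fps_X ^ (t * k - 1) * fps_X ^ (t * k + 1) :: rat fps) = fps_X ^ (2 * t * k)"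
    using tk(2) by (simp only: power_add[symmetric]) simp
  finally show ?thesis .
qed

text \<open>The index \<open>N\<close> belongs to the multiple \<open>k = N + 1\<close>, which
  satisfies \<open>k > 0\<close> as the partition recurrences require.\<close>

lemma lower_sum_eq_sum_gf: "lower_sum t N = sum_gf_from t (t * Suc N - 1)"
proof (rule fps_recurrence_unique[where f = "lower_sum t" and g = "mid_sum t"
      and f' = "\<lambda>N. sum_gf_from t (t * Suc N - 1)" and g' = "\<lambda>N. sum_gf_from t (t * Suc N)"
      and a = "\<lambda>N. fps_X ^ (t * Suc N - 1)" and b = "\<lambda>N. fps_X ^ (2 * t * Suc N)"
      and c = "\<lambda>N. fps_X ^ (t * Suc N + 1)" and d = "\<lambda>N. fps_X ^ (t * Suc N)"])
  have t1: "t > 1" using t by simp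
  show "lower_sum t N = mid_sum t N + fps_X ^ (t * Suc N - 1) * mid_sum t (Suc N) +
     fps_X ^ (2 * t * Suc N) * lower_sum t (Suc (Suc N))" for N
    by (rule lower_sum_rec[OF t1])
  show "mid_sum t N = lower_sum t (Suc N) + fps_X ^ (t * Suc N + 1) * lower_sum t (Suc (Suc N)) +
     fps_X ^ (t * Suc N) * mid_sum t (Suc N)" for N
    by (rule mid_sum_rec[OF t1])
  show "sum_gf_from t (t * Suc N - 1) = sum_gf_from t (t * Suc N) +
     fps_X ^ (t * Suc N - 1) * sum_gf_from t (t * Suc (Suc N)) +
     fps_X ^ (2 * t * Suc N) * sum_gf_from t (t * Suc (Suc (Suc N)) - 1)" for N
    by (rule sum_gf_from_multiple_minus) simp
  show "sum_gf_from t (t * Suc N) = sum_gf_from t (t * Suc (Suc N) - 1) +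
     fps_X ^ (t * Suc N + 1) * sum_gf_from t (t * Suc (Suc (Suc N)) - 1) +
     fps_X ^ (t * Suc N) * sum_gf_from t (t * Suc (Suc N))" for N
    unfolding sum_gf_from_multiple_plus[OF zero_less_Suc, symmetric]
    by (rule sum_gf_from_multiple) simp
  show "lower_sum t N $ n = sum_gf_from t (t * Suc N - 1) $ n"
    "mid_sum t N $ n = sum_gf_from t (t * Suc N) $ n" if "n < N" for N n
  proof -
    have "2 * Suc N \<le> t * Suc N"
      using t by (intro mult_le_mono) auto
    moreover have "n < m - 1" "n < m" if "2 * Suc N \<le> m" for m
      using that \<open>n < N\<close> by auto
    ultimately have "n < t * Suc N - 1" "n < t * Suc N" by blast+
    then show "lower_sum t N $ n = sum_gf_from t (t * Suc N - 1) $ n"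
      "mid_sum t N $ n = sum_gf_from t (t * Suc N) $ n"
      using that by (simp_all only: pair_sums_nth[OF t1] sum_gf_from_nth)
  qed
qed

lemma sum_gf_eq_lower_sum: "partition_gf (sum_class t) = lower_sum t 0"
proof -
  \<comment> \<open>The case \<open>k = 0\<close> of \<open>admissible_gap\<close>: the part 1 is
    excluded, so the bound \<open>t - 1\<close>, which is \<open>N = 0\<close>, captures the whole
    class.\<close>
  have "t - 1 \<le> x" if "admissible t x" for x
    using admissible_gap[of x 0] that by (auto simp: admissible_def)
  then have "{p. is_partition n p \<and> sum_class t p} = {p \<in> sum_parts_from t (t - 1). sum_list p = n}" for n
    by (auto simp: is_partition_def sum_parts_from_def sum_class_iff admissible_def)
  then show ?thesis
    by (simp add: lower_sum_eq_sum_gf sum_gf_from_def partition_gf_def list_gf_def)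
qed

end

theorem theorem6:
  fixes t :: nat
  assumes "t > 3"
  shows "convergent_prod (product_factor t) \<and>
         sum_term t summable_on UNIV \<and>
         (\<Prod>n. product_factor t n) = (\<Sum>\<^sub>\<infinity>k. sum_term t k) \<and>
         (\<Prod>n. product_factor t n) = partition_gf (product_class t) \<and>
         (\<Sum>\<^sub>\<infinity>k. sum_term t k) = partition_gf (sum_class t)"
proof -
  have t: "t > 1" using assms by simp
  have "product_factor t has_prod partition_gf (product_class t)"
    using raw_has_prod_product_factor[of t] by (simp add: has_prod_def)
  then have prod: "convergent_prod (product_factor t)" "(\<Prod>n. product_factor t n) = partition_gf (product_class t)"
    using raw_has_prod_product_factor[of t] by (auto simp: convergent_prod_def dest: has_prod_unique)
  have sum: "sum_term t summable_on UNIV" "(\<Sum>\<^sub>\<infinity>k. sum_term t k) = lower_sum t 0"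
    using has_sum_sum_term[OF t] by (simp_all add: has_sum_iff)
  show ?thesis
    using prod sum product_gf_eq_lower_sum[OF t] sum_gf_eq_lower_sum[OF assms] by simp
qed

end
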